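(* Let $\Omega\subset\mathbb{R}^d$ be a Lebesgue measurable set with $|\Omega|<\infty$, let $g_1,\dots,g_q\in L^2(\Omega)\setminus\{0\}$, let $\Lambda_1,\dots,\Lambda_q\subset\mathbb{R}^d$ be countable, and consider the set of windowed exponentials $\bigcup_{i=1}^{q}\mathcal{E}(g_i,\Lambda_i)$ in $L^2(\Omega)$. (i) Suppose $\bigcup_{i=1}^{q}\mathcal{E}(g_i,\Lambda_i)$ is a Bessel sequence in $L^2(\Omega)$ with Bessel constant $B$ and that $D^+(\Lambda_j)>0$ for some $j\in\{1,\dots,q\}$. Then $|g_j|\le\sqrt{B/D^+(\Lambda_j)}$ almost everywhere on $\Omega$. (ii) Suppose $\bigcup_{i=1}^{q}\mathcal{E}(g_i,\Lambda_i)$ is a frame for $L^2(\Omega)$ with frame bounds $A,B$ ($A<B$). Let $J'=\{j\in\{1,\dots,q\}:\|g_j\|_\infty<\infty\text{ and }D^+(\Lambda_j)>0\}$. Then $$\sqrt{A/D^+\Big(\sum_{j\in J'}\delta_{\Lambda_j}\Big)}\le\max_{j\in J'}|g_j|\le\max_{j\in J'}\sqrt{B/D^+(\Lambda_j)}$$ almost everywhere on $\Omega$.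
   Context: For a positive Borel measure $\mu$ on $\mathbb{R}^d$ the upper Beurling density is $D^+(\mu)=\limsup_{h\to\infty}\sup_{x\in\mathbb{R}^d}\frac{\mu(x+Q_h)}{h^d}$, where $Q_h$ is the cube of side length $h$ centered at the origin. For a countable set $\Lambda\subset\mathbb{R}^d$, $\delta_\Lambda=\sum_{\lambda\in\Lambda}\delta_\lambda$ and $D^+(\Lambda)=D^+(\delta_\Lambda)$. $\|g_j\|_\infty$ is the essential supremum of $|g_j|$ on $\Omega$. $\mathcal{E}(g_j,\Lambda_j)=\{g_j(x)e^{2\pi i\langle\lambda,x\rangle}:\lambda\in\Lambda_j\}$. The collection $\bigcup_{j=1}^q\mathcal{E}(g_j,\Lambda_j)$ (indexed by pairs $(j,\lambda)$) is a frame for $L^2(\Omega)$ with frame bounds $A,B\in(0,\infty)$ if for all $f\in L^2(\Omega)$ $$A\|f\|_{L^2(\Omega)}^2\le\sum_{j=1}^q\sum_{\lambda\in\Lambda_j}\left|\int_\Omega f(x)\overline{g_j(x)}e^{-2\pi i\langle\lambda,x\rangle}dx\right|^2\le B\|f\|_{L^2(\Omega)}^2 ;$$ it is a Bessel sequence with Bessel constant $B\in(0,\infty)$ if the second inequality holds for all $f\in L^2(\Omega)$. *)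

theory Defs
  imports "HOL-Probability.Probability"
begin

definition L2 :: "(real ^ 'n) set \<Rightarrow> (real ^ 'n \<Rightarrow> complex) set" where
  "L2 \<Omega> = {f \<in> borel_measurable (lebesgue_on \<Omega>).
     integrable (lebesgue_on \<Omega>) (\<lambda>x. (cmod (f x))\<^sup>2)}"

definition L2_norm_sq :: "(real ^ 'n) set \<Rightarrow> (real ^ 'n \<Rightarrow> complex) \<Rightarrow> real" where
  "L2_norm_sq \<Omega> f = (\<integral>x. (cmod (f x))\<^sup>2 \<partial>lebesgue_on \<Omega>)"

definition L2_inner :: "(real ^ 'n) set \<Rightarrow> (real ^ 'n \<Rightarrow> complex) \<Rightarrow> (real ^ 'n \<Rightarrow> complex) \<Rightarrow> complex" where
  "L2_inner \<Omega> f h = (\<integral>x. f x * cnj (h x) \<partial>lebesgue_on \<Omega>)"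

definition windowed_exp :: "(real ^ 'n \<Rightarrow> complex) \<Rightarrow> real ^ 'n \<Rightarrow> real ^ 'n \<Rightarrow> complex" where
  "windowed_exp g \<xi> x = g x * exp (2 * complex_of_real pi * \<i> * complex_of_real (\<xi> \<bullet> x))"

text \<open>The sums are taken in \<^typ>\<open>ennreal\<close>, so that a divergent sum has the value \<open>\<infinity>\<close>;
  \<^const>\<open>infsum\<close> over the reals would give 0 instead.\<close>

definition analysis_sum ::
  "(real ^ 'n) set \<Rightarrow> nat \<Rightarrow> (nat \<Rightarrow> real ^ 'n \<Rightarrow> complex) \<Rightarrow> (nat \<Rightarrow> (real ^ 'n) set)
    \<Rightarrow> (real ^ 'n \<Rightarrow> complex) \<Rightarrow> ennreal" where
  "analysis_sum \<Omega> q g \<Lambda> f =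
     (\<Sum>j=1..q. \<Sum>\<^sub>\<infinity>\<xi>\<in>\<Lambda> j. ennreal ((cmod (L2_inner \<Omega> f (windowed_exp (g j) \<xi>)))\<^sup>2))"

definition is_bessel ::
  "(real ^ 'n) set \<Rightarrow> nat \<Rightarrow> (nat \<Rightarrow> real ^ 'n \<Rightarrow> complex) \<Rightarrow> (nat \<Rightarrow> (real ^ 'n) set)
    \<Rightarrow> real \<Rightarrow> bool" where
  "is_bessel \<Omega> q g \<Lambda> B \<longleftrightarrow>
     0 < B \<and> (\<forall>f\<in>L2 \<Omega>. analysis_sum \<Omega> q g \<Lambda> f \<le> ennreal (B * L2_norm_sq \<Omega> f))"

definition is_frame ::
  "(real ^ 'n) set \<Rightarrow> nat \<Rightarrow> (nat \<Rightarrow> real ^ 'n \<Rightarrow> complex) \<Rightarrow> (nat \<Rightarrow> (real ^ 'n) set)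
    \<Rightarrow> real \<Rightarrow> real \<Rightarrow> bool" where
  "is_frame \<Omega> q g \<Lambda> A B \<longleftrightarrow>
     0 < A \<and> 0 < B \<and>
     (\<forall>f\<in>L2 \<Omega>. ennreal (A * L2_norm_sq \<Omega> f) \<le> analysis_sum \<Omega> q g \<Lambda> f
        \<and> analysis_sum \<Omega> q g \<Lambda> f \<le> ennreal (B * L2_norm_sq \<Omega> f))"

definition cube :: "real \<Rightarrow> (real ^ 'n) set" where
  "cube h = {y. \<forall>i. \<bar>y $ i\<bar> \<le> h / 2}"

definition upper_density :: "(real ^ 'n) measure \<Rightarrow> ennreal" where
  "upper_density \<mu> =
     Limsup at_top (\<lambda>h::real. SUP x. emeasure \<mu> ((+) x ` cube h) / ennreal (h ^ CARD('n)))"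

text \<open>The sum \<open>\<Sum>i\<in>I. M i\<close> of Borel measures; there is no addition on \<^typ>\<open>'a measure\<close>.
  The integral against \<^const>\<open>count_space\<close> is the unconditional sum of nonnegative terms
  over an arbitrary index set.\<close>

definition sum_measure :: "'i set \<Rightarrow> ('i \<Rightarrow> 'a::topological_space measure) \<Rightarrow> 'a measure" where
  "sum_measure I M =
     measure_of UNIV (sets borel) (\<lambda>E. \<integral>\<^sup>+ i. emeasure (M i) E \<partial>count_space I)"

text \<open>\<^term>\<open>return borel a\<close> is the Dirac measure at \<open>a\<close>.\<close>

definition delta :: "'a::topological_space set \<Rightarrow> 'a measure" where
  "delta \<Lambda> = sum_measure \<Lambda> (return borel)"

text \<open>Square root on \<open>[0, \<infinity>]\<close>.  Division in \<^typ>\<open>ennreal\<close> satisfies \<open>a / 0 = \<infinity>\<close> for \<open>a \<noteq> 0\<close>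
  and \<open>a / \<infinity> = 0\<close> for \<open>a \<noteq> \<infinity>\<close>.\<close>

definition esqrt :: "ennreal \<Rightarrow> ennreal" where
  "esqrt a = (if a = \<infinity> then \<infinity> else ennreal (sqrt (enn2real a)))"

lemma sets_sum_measure [simp]: "sets (sum_measure I M) = sets borel"
  unfolding sum_measure_def by (metis sets.sets_measure_of_eq space_borel)

lemma emeasure_sum_measure:
  assumes "\<And>i. i \<in> I \<Longrightarrow> sets (M i) = sets borel" and E: "E \<in> sets borel"
  shows "emeasure (sum_measure I M) E = (\<integral>\<^sup>+ i. emeasure (M i) E \<partial>count_space I)"
proof (rule emeasure_measure_of[OF sum_measure_def])
  show "countably_additive (sets (sum_measure I M)) (\<lambda>E. \<integral>\<^sup>+ i. emeasure (M i) E \<partial>count_space I)"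
  proof (rule countably_additiveI)
    fix F :: "nat \<Rightarrow> 'b set"
    assume F: "range F \<subseteq> sets (sum_measure I M)" "disjoint_family F"
    have "(\<Sum>n. \<integral>\<^sup>+ i. emeasure (M i) (F n) \<partial>count_space I)
        = (\<integral>\<^sup>+ i. (\<Sum>n. emeasure (M i) (F n)) \<partial>count_space I)"
      by (rule nn_integral_suminf[symmetric]) simp
    also have "\<dots> = (\<integral>\<^sup>+ i. emeasure (M i) (\<Union>n. F n) \<partial>count_space I)"
      by (intro nn_integral_cong suminf_emeasure) (use F assms in auto)
    finally show "(\<Sum>n. \<integral>\<^sup>+ i. emeasure (M i) (F n) \<partial>count_space I)
        = (\<integral>\<^sup>+ i. emeasure (M i) (\<Union> (range F)) \<partial>count_space I)" .
  qed
qed (use E in \<open>auto simp: positive_def\<close>)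

lemma emeasure_sum_measure_finite:
  assumes "finite I" "\<And>i. i \<in> I \<Longrightarrow> sets (M i) = sets borel" "E \<in> sets borel"
  shows "emeasure (sum_measure I M) E = (\<Sum>i\<in>I. emeasure (M i) E)"
  using assms by (simp add: emeasure_sum_measure nn_integral_count_space_finite)

lemma sets_delta [simp]: "sets (delta \<Lambda>) = sets borel"
  by (simp add: delta_def)

lemma emeasure_delta:
  assumes "E \<in> sets borel"
  shows "emeasure (delta \<Lambda>) E = emeasure (count_space UNIV) (\<Lambda> \<inter> E)"
proof -
  have "emeasure (delta \<Lambda>) E = (\<integral>\<^sup>+ l. indicator E l \<partial>count_space \<Lambda>)"
    unfolding delta_def using assms by (simp add: emeasure_sum_measure)
  also have "\<dots> = (\<integral>\<^sup>+ l. indicator (\<Lambda> \<inter> E) l \<partial>count_space UNIV)"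
    by (simp add: nn_integral_count_space_indicator indicator_inter_arith mult.commute
          del: nn_integral_indicator)
  finally show ?thesis by simp
qed

end

theory Submission
  imports Defs
begin

text \<open>
  Fix a bounded set \<open>E \<subseteq> \<Omega>\<close> on which the \<open>g\<^sub>j\<close> are bounded, and test the inequalities on the
  modulations \<open>1\<^sub>E(x) exp (2\<pi>i\<langle>y,x\<rangle>)\<close>.  The coefficient at \<open>(j, \<xi>)\<close> is \<open>F\<^sub>j(\<xi> - y)\<close>, where
  \<open>F\<^sub>j\<close> is the Fourier transform of \<open>1\<^sub>E\<close> times the conjugate of \<open>g\<^sub>j\<close>.  Integrating over \<open>y\<close> in the
  cube \<open>x + Q\<^sub>h\<close> turns the frame sum into \<open>\<Sum>j. \<integral> |F\<^sub>j(t)|\<^sup>2 #(\<Lambda>\<^sub>j \<inter> (x + t + Q\<^sub>h)) dt\<close>.  Most of the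
  mass of \<open>|F\<^sub>j|\<^sup>2\<close> lies in a fixed cube, so after division by \<open>h\<^sup>d\<close> and \<open>h \<rightarrow> \<infinity>\<close> Plancherel's
  theorem gives \<open>D\<^sup>+(\<Lambda>\<^sub>j) \<integral>\<^sub>E |g\<^sub>j|\<^sup>2 \<le> B |E|\<close>, and, if \<open>|g\<^sub>j| \<le> c\<close> on \<open>E\<close> for \<open>j \<in> J'\<close>,
  \<open>A |E| \<le> D\<^sup>+(\<Sum>j\<in>J'. \<delta>\<^bsub>\<Lambda>j\<^esub>) c\<^sup>2 |E|\<close>.  Countably many level sets \<open>E\<close> cover the exceptional sets,
  and each of them is null.
\<close>

section \<open>Continuity of translations in the mean\<close>

text \<open>The windows are merely in L2. On sets \<open>E\<close> where all of them are bounded,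
  the Fourier analysis reduces to bounded functions of bounded support. For these, Plancherel is
  Fourier inversion at 0 for the autocorrelation, and a Gaussian factor supplies the absolute
  convergence that Fubini asks for. The two density estimates compare cubes in opposite directions.
  For the upper bound, \<open>x + Q_h\<close> lies in \<open>x + t + Q_(h+2r)\<close>, and the tail
  of the transform may be discarded. For the lower bound, \<open>t + Q_h\<close> lies in
  \<open>Q_(h+2k)\<close>, and the tail has to be controlled, which uses that the density of the
  summed measure is finite; if it is infinite, the lower bound is 0. The obstacle in the lower bound
  is that windows outside \<open>J'\<close> cannot be dropped from the frame sum. Part (i) settles
  this: a window with positive density is essentially bounded, so outside \<open>J'\<close> the
  density is 0 and the contribution vanishes in the limit. A violated inequality is strict and
  leaves room for a rational threshold, which is why countably many level sets suffice.\<close>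

lemma nn_integral_lborel_affine:
  fixes t :: "'a::euclidean_space"
  assumes [measurable]: "f \<in> borel_measurable borel" and c: "c \<noteq> 0"
  shows "(\<integral>\<^sup>+x. f x \<partial>lborel) = ennreal (\<bar>c\<bar> ^ DIM('a)) * (\<integral>\<^sup>+x. f (t + c *\<^sub>R x) \<partial>lborel)"
  by (subst lborel_affine[OF c, of t])
     (simp add: nn_integral_density nn_integral_distr nn_integral_cmult)

lemma integrable_lborel_affine:
  fixes t :: "'a::euclidean_space" and f :: "'a \<Rightarrow> 'b::{banach, second_countable_topology}"
  assumes f: "integrable lborel f" and c: "c \<noteq> 0"
  shows "integrable lborel (\<lambda>x. f (t + c *\<^sub>R x))"
  using f f[THEN borel_measurable_integrable] c unfolding integrable_iff_bounded
  by (subst (asm) nn_integral_lborel_affine[where c=c and t=t]) (auto simp: ennreal_mult_less_top)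

lemma integral_lborel_affine:
  fixes t :: "'a::euclidean_space" and f :: "'a \<Rightarrow> 'b::{banach, second_countable_topology}"
  assumes f: "integrable lborel f" and c: "c \<noteq> 0"
  shows "(\<integral>x. f x \<partial>lborel) = (\<bar>c\<bar> ^ DIM('a)) *\<^sub>R (\<integral>x. f (t + c *\<^sub>R x) \<partial>lborel)"
proof -
  note [measurable] = f[THEN borel_measurable_integrable]
  show ?thesis
    using integrable_lborel_affine[OF f c, of t] c
    by (subst lborel_affine[OF c, of t]) (simp add: integral_density integral_distr)
qed

lemma integrable_indicator_cball: "integrable lborel (indicator (cball (a::'a::euclidean_space) r) :: 'a \<Rightarrow> real)"
  by (intro integrable_real_indicator) (use emeasure_bounded_finite[OF bounded_cball, of a r] in auto)

lemma integrable_bounded_support: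
  fixes f :: "'a::euclidean_space \<Rightarrow> 'b::{banach, second_countable_topology}"
  assumes "f \<in> borel_measurable borel"
    and "\<And>x. norm (f x) \<le> M" "\<And>x. r < norm x \<Longrightarrow> f x = 0"
  shows "integrable lborel f"
proof (rule Bochner_Integration.integrable_bound)
  show "integrable lborel (\<lambda>x. M * indicator (cball (0::'a) r) x)"
    by (intro integrable_mult_right integrable_indicator_cball)
  show "AE x in lborel. norm (f x) \<le> norm (M * indicator (cball 0 r) x)"
    using assms(2,3) by (intro AE_I2) (force simp: indicator_def not_le intro: order_trans)
qed (use assms in auto)

text \<open>Dominated convergence: continuity gives the pointwise limit, and since the shifts are
  bounded by some \<open>C\<close>, all differences live in one ball of radius
  \<open>r + C\<close>.\<close>

lemma L1_translation_continuous:
  fixes h :: "'a::euclidean_space \<Rightarrow> 'b::euclidean_space"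
  assumes h: "continuous_on UNIV h"
    and M: "\<And>x. norm (h x) \<le> M" and r: "\<And>x. r < norm x \<Longrightarrow> h x = 0"
    and Z: "Z \<longlonglongrightarrow> 0"
  shows "(\<lambda>k. \<integral>x. norm (h (x + Z k) - h x) \<partial>lborel) \<longlonglongrightarrow> 0"
proof -
  have hm[measurable]: "h \<in> borel_measurable borel"
    by (rule borel_measurable_continuous_onI[OF h])
  have "Bseq Z"
    using Z convergentI convergent_imp_Bseq by blast
  then obtain C where C: "\<And>k. norm (Z k) \<le> C"
    by (meson BseqE)
  have "(\<lambda>k. \<integral>x. norm (h (x + Z k) - h x) \<partial>lborel) \<longlonglongrightarrow> integral\<^sup>L lborel (\<lambda>x::'a. 0)"
  proof (rule integral_dominated_convergence[where w="\<lambda>x. 2 * M * indicator (cball (0::'a) (r + C)) x"])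
    show "integrable lborel (\<lambda>x. 2 * M * indicator (cball (0::'a) (r + C)) x)"
      by (intro integrable_mult_right integrable_indicator_cball)
    show "AE x in lborel. norm (norm (h (x + Z k) - h x)) \<le> 2 * M * indicator (cball 0 (r + C)) x" for k
    proof (intro AE_I2)
      fix x
      show "norm (norm (h (x + Z k) - h x)) \<le> 2 * M * indicator (cball 0 (r + C)) x"
      proof (cases "norm x \<le> r + C")
        case True
        have "norm (h (x + Z k) - h x) \<le> M + M"
          by (intro order_trans[OF norm_triangle_ineq4] add_mono M)
        with True show ?thesis by simp
      next
        case False
        have "norm x \<le> norm (x + Z k) + norm (Z k)"
          by (metis add_diff_cancel_right' norm_triangle_ineq4)
        with False C[of k] norm_ge_zero[of "Z k"] have "r < norm (x + Z k)" "r < norm x"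
          by linarith+
        with r False show ?thesis by simp
      qed
    qed
    show "AE x in lborel. (\<lambda>k. norm (h (x + Z k) - h x)) \<longlonglongrightarrow> 0"
    proof (intro AE_I2)
      fix x
      have "(\<lambda>k. h (x + Z k)) \<longlonglongrightarrow> h (x + 0)"
        using h by (intro isCont_tendsto_compose[of _ h] tendsto_intros Z)
                   (auto simp: continuous_on_eq_continuous_at)
      then show "(\<lambda>k. norm (h (x + Z k) - h x)) \<longlonglongrightarrow> 0"
        using LIM_zero tendsto_norm_zero by fastforce
    qed
  qed auto
  then show ?thesis by simp
qed

text \<open>A measurable function is almost everywhere a limit of continuous functions
  \<open>g n\<close>. These are truncated in size and in support, which keeps them continuous, does
  not change the limit and makes dominated convergence available.\<close>

lemma L1_approx_continuous:
  fixes f :: "'a::euclidean_space \<Rightarrow> 'b::euclidean_space"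
  assumes [measurable]: "f \<in> borel_measurable borel"
    and M: "\<And>x. norm (f x) \<le> M" and r: "\<And>x. r < norm x \<Longrightarrow> f x = 0" and "0 < e"
  obtains h where "continuous_on UNIV h" "\<And>x. norm (h x) \<le> max M 1"
    "\<And>x. r + 1 < norm x \<Longrightarrow> h x = 0" "(\<integral>x. norm (h x - f x) \<partial>lborel) < e"
proof -
  have "f measurable_on UNIV"
    by (rule lebesgue_measurable_imp_measurable_on) (auto intro: measurable_completion)
  then obtain N g where N: "negligible N" and g: "\<And>n::nat. continuous_on UNIV (g n)"
    and lim: "\<And>x. x \<notin> N \<Longrightarrow> (\<lambda>n. g n x) \<longlonglongrightarrow> f x"
    unfolding measurable_on_def by auto
  \<comment> \<open>\<open>M\<close> may be 0; a positive bound is wanted because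
    \<open>max M' (norm (g n x))\<close> becomes a denominator.\<close>
  define M' where "M' = max M 1"
  have M': "M' > 0" "\<And>x. norm (f x) \<le> M'"
    using M by (auto simp: M'_def le_max_iff_disj)
  \<comment> \<open>A continuous cut-off that is 1 up to radius \<open>r\<close> and falls to 0 at
    radius \<open>r + 1\<close>; hence the \<open>r + 1\<close> in the conclusion.\<close>
  define w where "w = (\<lambda>x::'a. min 1 (max 0 (r + 1 - norm x)))"
  define h where "h = (\<lambda>n x. (w x * (M' / max M' (norm (g n x)))) *\<^sub>R g n x)"
  have hc: "continuous_on UNIV (h n)" for n
    unfolding h_def w_def using M' by (intro continuous_intros g) auto
  have [measurable]: "h n \<in> borel_measurable borel" for n
    by (rule borel_measurable_continuous_onI[OF hc])
  have hM: "norm (h n x) \<le> M'" for n x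
  proof -
    have "norm (h n x) = \<bar>w x\<bar> * (M' / max M' (norm (g n x)) * norm (g n x))"
      using M' by (simp add: h_def abs_mult)
    also have "\<dots> \<le> 1 * M'"
      using M' by (intro mult_mono) (auto simp: w_def divide_simps max_def)
    finally show ?thesis by simp
  qed
  have hr: "h n x = 0" if "r + 1 < norm x" for n x
    using that by (simp add: h_def w_def)
  have hlim: "(\<lambda>n. h n x) \<longlonglongrightarrow> f x" if "x \<notin> N" for x
  proof -
    have "(\<lambda>n. h n x) \<longlonglongrightarrow> (w x * (M' / max M' (norm (f x)))) *\<^sub>R f x"
      unfolding h_def using M' by (intro tendsto_intros lim that) auto
    also have "(w x * (M' / max M' (norm (f x)))) *\<^sub>R f x = f x"
      using M' r[of x] by (cases "norm x \<le> r") (auto simp: w_def max_absorb1)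
    finally show ?thesis .
  qed
  have "(\<lambda>n. \<integral>x. norm (h n x - f x) \<partial>lborel) \<longlonglongrightarrow> integral\<^sup>L lborel (\<lambda>x::'a. 0)"
  proof (rule integral_dominated_convergence[where w="\<lambda>x. 2 * M' * indicator (cball (0::'a) (r + 1)) x"])
    show "integrable lborel (\<lambda>x. 2 * M' * indicator (cball (0::'a) (r + 1)) x)"
      by (intro integrable_mult_right integrable_indicator_cball)
    show "AE x in lborel. norm (norm (h k x - f x)) \<le> 2 * M' * indicator (cball 0 (r + 1)) x" for k
    proof (intro AE_I2)
      fix x
      have "norm (h k x - f x) \<le> M' + M'"
        by (intro order_trans[OF norm_triangle_ineq4] add_mono M' hM)
      then show "norm (norm (h k x - f x)) \<le> 2 * M' * indicator (cball 0 (r + 1)) x"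
        using hr[of x k] r[of x] by (cases "norm x \<le> r + 1") auto
    qed
    have "AE x in lebesgue. x \<notin> N"
      using N by (simp add: AE_not_in negligible_iff_null_sets)
    then have "AE x in lborel. x \<notin> N"
      by (simp add: AE_completion_iff)
    then show "AE x in lborel. (\<lambda>k. norm (h k x - f x)) \<longlonglongrightarrow> 0"
      by eventually_elim (use hlim LIM_zero tendsto_norm_zero in blast)
  qed auto
  then have "eventually (\<lambda>n. (\<integral>x. norm (h n x - f x) \<partial>lborel) < e) sequentially"
    using order_tendstoD(2)[OF _ \<open>0 < e\<close>] by simp
  then obtain n where "(\<integral>x. norm (h n x - f x) \<partial>lborel) < e"
    by (auto simp: eventually_sequentially)
  with that[of "h n"] hc hM hr show thesis by (auto simp: M'_def)
qed

text \<open>Three-epsilon argument through a continuous approximation \<open>h\<close>: the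
  translated error has the same integral as the error itself, and the middle term is the continuous
  case.\<close>

lemma L1_translation:
  fixes f :: "'a::euclidean_space \<Rightarrow> 'b::euclidean_space"
  assumes f[measurable]: "f \<in> borel_measurable borel"
    and M: "\<And>x. norm (f x) \<le> M" and r: "\<And>x. r < norm x \<Longrightarrow> f x = 0"
    and Z: "Z \<longlonglongrightarrow> 0"
  shows "(\<lambda>k. \<integral>x. norm (f (x + Z k) - f x) \<partial>lborel) \<longlonglongrightarrow> 0"
proof (rule LIMSEQ_I)
  fix e :: real assume "0 < e"
  then have "0 < e / 3" by simp
  from L1_approx_continuous[OF f M r this] obtain h where
    h: "continuous_on UNIV h" "\<And>x. norm (h x) \<le> max M 1"
    "\<And>x. r + 1 < norm x \<Longrightarrow> h x = 0" and he: "(\<integral>x. norm (h x - f x) \<partial>lborel) < e / 3"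
    by blast
  have hm[measurable]: "h \<in> borel_measurable borel"
    by (rule borel_measurable_continuous_onI[OF h(1)])
  have hi: "integrable lborel h" by (rule integrable_bounded_support[OF hm h(2,3)])
  have fi: "integrable lborel f" by (rule integrable_bounded_support[OF f M r])
  have tr: "(\<integral>x. u (x + z) \<partial>lborel) = (\<integral>x. u x \<partial>lborel)" if "integrable lborel u"
    for u :: "'a \<Rightarrow> real" and z
    using integral_lborel_affine[OF that, of 1 z] by (simp add: add.commute)
  have int: "integrable lborel (\<lambda>x. norm (h (x + Z k) - f (x + Z k)))"
    "integrable lborel (\<lambda>x. norm (h (x + Z k) - h x))" "integrable lborel (\<lambda>x. norm (h x - f x))"
    "integrable lborel (\<lambda>x. norm (f (x + Z k) - f x))" for k
    using integrable_lborel_affine[OF hi, of 1 "Z k"] integrable_lborel_affine[OF fi, of 1 "Z k"] hi fi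
    by (auto simp: add.commute)
  have "eventually (\<lambda>k. (\<integral>x. norm (h (x + Z k) - h x) \<partial>lborel) < e / 3) sequentially"
    using L1_translation_continuous[OF h Z] \<open>0 < e / 3\<close> by (rule order_tendstoD(2))
  then obtain K where K: "\<And>k. k \<ge> K \<Longrightarrow> (\<integral>x. norm (h (x + Z k) - h x) \<partial>lborel) < e / 3"
    by (auto simp: eventually_sequentially)
  show "\<exists>K. \<forall>k\<ge>K. norm ((\<integral>x. norm (f (x + Z k) - f x) \<partial>lborel) - 0) < e"
  proof (intro exI[of _ K] allI impI)
    fix k assume "K \<le> k"
    let ?a = "\<lambda>x. norm (h (x + Z k) - f (x + Z k))" and ?b = "\<lambda>x. norm (h (x + Z k) - h x)"
      and ?c = "\<lambda>x. norm (h x - f x)"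
    have "(\<integral>x. norm (f (x + Z k) - f x) \<partial>lborel) \<le> (\<integral>x. ?a x + ?b x + ?c x \<partial>lborel)"
    proof (rule integral_mono)
      show "norm (f (x + Z k) - f x) \<le> ?a x + ?b x + ?c x" for x
      proof -
        have "f (x + Z k) - f x = - (h (x + Z k) - f (x + Z k)) + (h (x + Z k) - h x) + (h x - f x)"
          by simp
        also have "norm \<dots> \<le> ?a x + ?b x + ?c x"
          by (metis norm_add_rule_thm norm_minus_cancel norm_triangle_mono order_refl)
        finally show ?thesis .
      qed
    qed (intro int Bochner_Integration.integrable_add)+
    also have "\<dots> = (\<integral>x. ?a x \<partial>lborel) + (\<integral>x. ?b x \<partial>lborel) + (\<integral>x. ?c x \<partial>lborel)"
      using int by simp
    also have "(\<integral>x. ?a x \<partial>lborel) = (\<integral>x. ?c x \<partial>lborel)"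
      using tr[OF int(3)] by simp
    also have "\<dots> + (\<integral>x. ?b x \<partial>lborel) + (\<integral>x. ?c x \<partial>lborel) < e / 3 + e / 3 + e / 3"
      by (intro add_strict_mono he K \<open>K \<le> k\<close>)
    finally show "norm ((\<integral>x. norm (f (x + Z k) - f x) \<partial>lborel) - 0) < e"
      by simp
  qed
qed

section \<open>Plancherel's theorem for bounded functions of bounded support\<close>

text \<open>This is the characteristic function of the standard normal distribution with the
  density's factor \<open>1 / sqrt (2 * pi)\<close> removed.\<close>

lemma gaussian_fourier_real:
  "has_bochner_integral lborel (\<lambda>x. cis (t * x) * complex_of_real (exp (- x\<^sup>2 / 2)))
     (complex_of_real (sqrt (2 * pi) * exp (- t\<^sup>2 / 2)))"
proof -
  have bound: "integrable lborel (\<lambda>x. sqrt (2 * pi) * std_normal_density x)"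
    by (intro integrable_mult_right integrable_normal_density) auto
  have int: "integrable lborel (\<lambda>x. cis (t * x) * complex_of_real (exp (- x\<^sup>2 / 2)))"
    by (rule Bochner_Integration.integrable_bound[OF bound])
       (auto simp: norm_mult std_normal_density_def cis_conv_exp intro!: AE_I2)
  have "complex_of_real (exp (- (t^2) / 2)) = (LINT x|std_normal_distribution. iexp (t * x))"
    using char_std_normal_distribution by (simp add: char_def fun_eq_iff)
  also have "\<dots> = (LINT x|lborel. std_normal_density x *\<^sub>R iexp (t * x))"
    by (subst integral_density) (auto simp: normal_density_nonneg)
  also have "\<dots> = (LINT x|lborel. complex_of_real (1 / sqrt (2 * pi)) *
      (cis (t * x) * complex_of_real (exp (- x\<^sup>2 / 2))))"
    by (intro Bochner_Integration.integral_cong)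
       (auto simp: std_normal_density_def cis_conv_exp scaleR_conv_of_real)
  also have "\<dots> = complex_of_real (1 / sqrt (2 * pi)) *
      (LINT x|lborel. cis (t * x) * complex_of_real (exp (- x\<^sup>2 / 2)))"
    by simp
  finally show ?thesis
    using int by (simp add: has_bochner_integral_iff field_simps)
qed

text \<open>Both the character and the Gaussian are products over the coordinates, so the integral
  factors into one-dimensional ones.\<close>

lemma gaussian_fourier:
  fixes s :: "'a::euclidean_space"
  shows "has_bochner_integral lborel (\<lambda>x. cis (s \<bullet> x) * complex_of_real (exp (- (norm x)\<^sup>2 / 2)))
     (complex_of_real (sqrt (2 * pi) ^ DIM('a) * exp (- (norm s)\<^sup>2 / 2)))"
proof -
  interpret product_sigma_finite "\<lambda>_::'a. lborel :: real measure" ..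
  let ?f = "\<lambda>b x. cis ((s \<bullet> b) * x) * complex_of_real (exp (- x\<^sup>2 / 2))"
  have cis_sum: "cis (sum u B) = (\<Prod>b\<in>B. cis (u b))" if "finite B" for u and B :: "'a set"
    using that by (induction B) (auto simp: cis_mult[symmetric])
  have sq: "(norm x)\<^sup>2 = (\<Sum>b\<in>Basis. (x \<bullet> b)\<^sup>2)" for x :: 'a
    unfolding power2_norm_eq_inner by (subst euclidean_inner) (simp add: power2_eq_square)
  have eq: "cis (s \<bullet> x) * complex_of_real (exp (- (norm x)\<^sup>2 / 2)) = (\<Prod>b\<in>Basis. ?f b (x \<bullet> b))" for x
    by (subst euclidean_inner)
       (simp add: sq cis_sum prod.distrib sum_negf[symmetric] sum_divide_distrib exp_sum del: of_real_exp)
  have int: "integrable lborel (?f b)" "integral\<^sup>L lborel (?f b)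
      = complex_of_real (sqrt (2 * pi) * exp (- (s \<bullet> b)\<^sup>2 / 2))" for b
    using gaussian_fourier_real[of "s \<bullet> b"] by (auto simp: has_bochner_integral_iff)
  have "has_bochner_integral (\<Pi>\<^sub>M b\<in>Basis. lborel) (\<lambda>x. \<Prod>b\<in>Basis. ?f b (x b))
      (\<Prod>b\<in>Basis. integral\<^sup>L lborel (?f b))"
    unfolding has_bochner_integral_iff
    using product_integral_prod[of Basis ?f] product_integrable_prod[of Basis ?f] int(1) by auto
  also have "(\<Prod>b\<in>Basis. integral\<^sup>L lborel (?f b))
      = complex_of_real (\<Prod>b\<in>Basis. sqrt (2 * pi) * exp (- (s \<bullet> b)\<^sup>2 / 2))"
    by (simp only: int of_real_prod)
  also have "(\<Prod>b\<in>Basis. sqrt (2 * pi) * exp (- (s \<bullet> b)\<^sup>2 / 2)) = sqrt (2 * pi) ^ DIM('a) * exp (- (norm s)\<^sup>2 / 2)"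
    by (simp add: prod.distrib sq sum_negf[symmetric] sum_divide_distrib exp_sum)
  finally have "has_bochner_integral (\<Pi>\<^sub>M b\<in>Basis. lborel) (\<lambda>x. \<Prod>b\<in>Basis. ?f b (x b))
     (complex_of_real (sqrt (2 * pi) ^ DIM('a) * exp (- (norm s)\<^sup>2 / 2)))" .
  \<comment> \<open>\<open>lborel\<close> is the image of the product measure under the map from
    coordinates to vectors; the integrand is rewritten as a function of that vector.\<close>
  then have "has_bochner_integral (\<Pi>\<^sub>M b\<in>Basis. lborel)
      (\<lambda>x. \<Prod>b\<in>Basis. ?f b ((\<Sum>b'\<in>Basis. x b' *\<^sub>R b') \<bullet> b))
     (complex_of_real (sqrt (2 * pi) ^ DIM('a) * exp (- (norm s)\<^sup>2 / 2)))"
    by (rule has_bochner_integral_cong[THEN iffD1, rotated -1]) auto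
  then show ?thesis
    unfolding eq by (subst lborel_eq, intro has_bochner_integral_distr) (auto simp: cis_conv_exp)
qed

lemma gaussian_fourier_scaled:
  fixes z :: "'a::euclidean_space"
  assumes c: "c > 0"
  shows "has_bochner_integral lborel
     (\<lambda>t. cis (- (2 * pi * (t \<bullet> z))) * complex_of_real (exp (- (norm (c *\<^sub>R t))\<^sup>2 / 2)))
     (complex_of_real (sqrt (2 * pi) ^ DIM('a) / c ^ DIM('a) * exp (- (norm ((2 * pi / c) *\<^sub>R z))\<^sup>2 / 2)))"
proof -
  \<comment> \<open>Chosen so that the substitution \<open>x = c *\<^sub>R t\<close> turns the
    frequency \<open>s\<close> into the character with argument
    \<open>- (2 * pi * (t \<bullet> z))\<close>.\<close>
  define s where "s = (- (2 * pi / c)) *\<^sub>R z"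
  let ?f = "\<lambda>x. cis (s \<bullet> x) * complex_of_real (exp (- (norm x)\<^sup>2 / 2))"
  have G: "integrable lborel ?f" "integral\<^sup>L lborel ?f
      = complex_of_real (sqrt (2 * pi) ^ DIM('a) * exp (- (norm s)\<^sup>2 / 2))"
    using gaussian_fourier[of s] by (auto simp: has_bochner_integral_iff)
  have *: "s \<bullet> (c *\<^sub>R t) = - (2 * pi * (t \<bullet> z))" for t
    using c by (simp add: s_def inner_commute)
  have ns: "norm ((2 * pi / c) *\<^sub>R z) = norm s"
    by (simp add: s_def)
  have "integrable lborel (\<lambda>t. ?f (0 + c *\<^sub>R t))"
    "integral\<^sup>L lborel ?f = c ^ DIM('a) *\<^sub>R (\<integral>t. ?f (0 + c *\<^sub>R t) \<partial>lborel)"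
    using integrable_lborel_affine[OF G(1), of c 0] integral_lborel_affine[OF G(1), of c 0] c by auto
  then show ?thesis
    using c unfolding G(2) add_0_left * has_bochner_integral_iff ns
    by (simp add: field_simps scaleR_conv_of_real del: norm_scaleR)
qed

section \<open>Fourier transform and autocorrelation\<close>

text \<open>The factor \<open>2 * pi\<close> in the exponent matches \<open>windowed_exp\<close> and
  makes Plancherel's identity free of constants.\<close>

definition fourier :: "('a::euclidean_space \<Rightarrow> complex) \<Rightarrow> 'a \<Rightarrow> complex" where
  "fourier f t = (\<integral>x. cis (- (2 * pi * (t \<bullet> x))) * f x \<partial>lborel)"

lemma borel_measurable_cis [measurable]: "cis \<in> borel_measurable borel"
  unfolding cis_conv_exp[abs_def] by measurable

lemma borel_measurable_cnj [measurable]: "cnj \<in> borel_measurable borel"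
  by (intro borel_measurable_continuous_onI continuous_intros)

lemma borel_measurable_fourier [measurable]:
  assumes [measurable]: "f \<in> borel_measurable borel"
  shows "fourier f \<in> borel_measurable borel"
  unfolding fourier_def[abs_def] by measurable

text \<open>The convolution of \<open>f\<close> with its reflected conjugate. Its transform is the
  squared modulus of \<open>fourier f\<close>, and its value at 0 is the squared norm of
  \<open>f\<close>.\<close>

definition autocorrelation :: "('a::euclidean_space \<Rightarrow> complex) \<Rightarrow> 'a \<Rightarrow> complex" where
  "autocorrelation f z = (\<integral>x. f (x + z) * cnj (f x) \<partial>lborel)"

locale bounded_support =
  fixes f :: "'a::euclidean_space \<Rightarrow> complex" and M r :: real
  assumes borel [measurable]: "f \<in> borel_measurable borel"
    and bound: "\<And>x. cmod (f x) \<le> M" and support: "\<And>x. r < norm x \<Longrightarrow> f x = 0"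
begin

lemma integrable: "integrable lborel f"
  by (rule integrable_bounded_support[OF borel bound support])

lemma M_nonneg: "0 \<le> M"
  using norm_ge_zero bound[of 0] by (rule order_trans)

lemma integrable_shift: "integrable lborel (\<lambda>x. f (x + z))"
  using integrable_lborel_affine[OF integrable, of 1 z] by (simp add: add.commute)

lemma integrable_shift_mult: "integrable lborel (\<lambda>x. f (x + z) * cnj (f x))"
  by (rule Bochner_Integration.integrable_bound[of _ "\<lambda>x. M * cmod (f x)"])
     (auto simp: norm_mult integrable abs_mult M_nonneg intro!: AE_I2 mult_right_mono bound)

lemma autocorrelation_borel [measurable]: "autocorrelation f \<in> borel_measurable borel"
  unfolding autocorrelation_def[abs_def] by measurable

lemma autocorrelation_bound: "cmod (autocorrelation f z) \<le> M * (\<integral>x. cmod (f x) \<partial>lborel)"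
proof -
  have "cmod (autocorrelation f z) \<le> (\<integral>x. cmod (f (x + z) * cnj (f x)) \<partial>lborel)"
    unfolding autocorrelation_def by (rule integral_norm_bound)
  also have "\<dots> \<le> (\<integral>x. M * cmod (f x) \<partial>lborel)"
    using integrable_shift_mult[of z, THEN integrable_norm] integrable
    by (intro integral_mono) (auto simp: norm_mult intro!: mult_right_mono bound)
  finally show ?thesis by simp
qed

lemma shift_mult_support: "2 * r < norm z \<Longrightarrow> f (x + z) * cnj (f x) = 0"
proof -
  assume z: "2 * r < norm z"
  have "norm z \<le> norm (x + z) + norm x"
    by (metis add_diff_cancel_left' norm_triangle_ineq4)
  with z have "r < norm (x + z) \<or> r < norm x" by linarith
  with support show ?thesis by auto
qed

lemma autocorrelation_support: "2 * r < norm z \<Longrightarrow> autocorrelation f z = 0"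
  by (simp only: autocorrelation_def shift_mult_support Bochner_Integration.integral_zero)

lemma integrable_autocorrelation: "integrable lborel (autocorrelation f)"
  by (rule integrable_bounded_support[OF autocorrelation_borel autocorrelation_bound autocorrelation_support])

text \<open>The difference of the values at \<open>Z k\<close> and 0 is at most \<open>M\<close>
  times the L1 distance between \<open>f\<close> and its translate.\<close>

lemma autocorrelation_tendsto:
  assumes "Z \<longlonglongrightarrow> 0"
  shows "(\<lambda>k. autocorrelation f (Z k)) \<longlonglongrightarrow> autocorrelation f 0"
proof (rule LIM_zero_cancel, rule Lim_null_comparison)
  show "eventually (\<lambda>k. norm (autocorrelation f (Z k) - autocorrelation f 0)
      \<le> M * (\<integral>x. norm (f (x + Z k) - f x) \<partial>lborel)) sequentially"
  proof (intro always_eventually allI)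
    fix k
    have "autocorrelation f (Z k) - autocorrelation f 0 = (\<integral>x. (f (x + Z k) - f x) * cnj (f x) \<partial>lborel)"
      using integrable_shift_mult[of "Z k"] integrable_shift_mult[of 0]
      by (simp add: autocorrelation_def left_diff_distrib)
    also have "cmod \<dots> \<le> (\<integral>x. cmod ((f (x + Z k) - f x) * cnj (f x)) \<partial>lborel)"
      by (rule integral_norm_bound)
    also have "\<dots> \<le> (\<integral>x. M * cmod (f (x + Z k) - f x) \<partial>lborel)"
    proof (rule integral_mono)
      show "integrable lborel (\<lambda>x. cmod ((f (x + Z k) - f x) * cnj (f x)))"
        using integrable_shift_mult[of "Z k"] integrable_shift_mult[of 0]
        by (intro integrable_norm) (simp add: left_diff_distrib)
      show "integrable lborel (\<lambda>x. M * cmod (f (x + Z k) - f x))"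
        using integrable_shift[of "Z k"] integrable by simp
    qed (auto simp: norm_mult mult.commute[of M] intro!: mult_left_mono bound)
    finally show "norm (autocorrelation f (Z k) - autocorrelation f 0)
      \<le> M * (\<integral>x. norm (f (x + Z k) - f x) \<partial>lborel)" by simp
  qed
  show "(\<lambda>k. M * (\<integral>x. norm (f (x + Z k) - f x) \<partial>lborel)) \<longlonglongrightarrow> 0"
    using tendsto_mult_right_zero[OF L1_translation[OF borel bound support assms]] by simp
qed

text \<open>The squared modulus is a double integral of \<open>f\<close> against its conjugate;
  translating the inner variable by \<open>x\<close> leaves only the character of the difference
  \<open>z\<close>, and Fubini integrates over \<open>x\<close> first.\<close>

lemma fourier_autocorrelation:
  "fourier (autocorrelation f) t = complex_of_real ((cmod (fourier f t))\<^sup>2)"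
proof -
  let ?e = "\<lambda>x. cis (- (2 * pi * (t \<bullet> x)))"
  let ?h = "\<lambda>(x, z). ?e z * (f (x + z) * cnj (f x))"
  have int: "integrable (lborel \<Otimes>\<^sub>M lborel) ?h"
    unfolding lborel_prod
  proof (rule integrable_bounded_support)
    show "?h \<in> borel_measurable borel"
      unfolding borel_prod[symmetric] by measurable
    show "norm (?h p) \<le> M * M" for p
      using M_nonneg by (auto simp: norm_mult split: prod.split intro!: mult_mono bound)
    \<comment> \<open>If the pair \<open>(x, z)\<close> has norm above \<open>3 * r\<close>, then
      either \<open>x\<close> exceeds \<open>r\<close> or \<open>z\<close> exceeds
      \<open>2 * r\<close>, and in both cases a factor vanishes.\<close>
    show "?h p = 0" if "3 * r < norm p" for p
    proof (cases p)
      case (Pair x z)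
      have "norm p \<le> norm x + norm z"
        unfolding Pair by (rule norm_Pair_le)
      with that have "r < norm x \<or> 2 * r < norm z" by linarith
      with shift_mult_support[of z x] support[of x] show ?thesis
        by (auto simp: Pair)
    qed
  qed
  have e_int: "integrable lborel (\<lambda>x. ?e x * f x)"
    by (rule Bochner_Integration.integrable_bound[OF integrable]) (auto simp: norm_mult)
  have "complex_of_real ((cmod (fourier f t))\<^sup>2) = fourier f t * cnj (\<integral>x. ?e x * f x \<partial>lborel)"
    unfolding fourier_def[symmetric] by (simp only: complex_norm_square)
  also have "\<dots> = (\<integral>x. fourier f t * cnj (?e x * f x) \<partial>lborel)"
    using e_int by (simp add: integral_cnj[symmetric] del: complex_cnj_mult)
  also have "\<dots> = (\<integral>x. (\<integral>z. ?h (x, z) \<partial>lborel) \<partial>lborel)"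
  proof (intro Bochner_Integration.integral_cong refl)
    fix x
    have "fourier f t = (\<integral>z. ?e (x + z) * f (x + z) \<partial>lborel)"
      using integral_lborel_affine[OF e_int, of 1 x] by (simp add: fourier_def)
    then have "fourier f t * cnj (?e x * f x) = (\<integral>z. ?e (x + z) * f (x + z) * cnj (?e x * f x) \<partial>lborel)"
      by simp
    also have "\<dots> = (\<integral>z. ?h (x, z) \<partial>lborel)"
    proof (intro Bochner_Integration.integral_cong refl)
      fix z
      have "?e (x + z) * cnj (?e x) = ?e z"
        by (simp only: cis_cnj cis_mult) (simp add: inner_add_right distrib_left)
      moreover have "?e (x + z) * f (x + z) * cnj (?e x * f x) = (?e (x + z) * cnj (?e x)) * (f (x + z) * cnj (f x))"
        by (simp only: complex_cnj_mult mult_ac)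
      ultimately show "?e (x + z) * f (x + z) * cnj (?e x * f x) = ?h (x, z)"
        by simp
    qed
    finally show "fourier f t * cnj (?e x * f x) = (\<integral>z. ?h (x, z) \<partial>lborel)" .
  qed
  also have "\<dots> = (\<integral>z. (\<integral>x. ?h (x, z) \<partial>lborel) \<partial>lborel)"
    using lborel_pair.Fubini_integral[of "\<lambda>x z. ?h (x, z)"] int by simp
  also have "\<dots> = fourier (autocorrelation f) t"
    by (simp add: fourier_def autocorrelation_def)
  finally show ?thesis ..
qed

text \<open>Both sides tend to the two sides of Plancherel's identity as \<open>c \<rightarrow> 0\<close>.\<close>

lemma gaussian_mean_fourier:
  assumes c: "c > 0"
  shows "has_bochner_integral lborel
      (\<lambda>t. (cmod (fourier f t))\<^sup>2 * exp (- (norm (c *\<^sub>R t))\<^sup>2 / 2))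
      (Re (\<integral>w. autocorrelation f ((c / (2 * pi)) *\<^sub>R w) * complex_of_real (exp (- (norm w)\<^sup>2 / 2)) \<partial>lborel)
         / sqrt (2 * pi) ^ DIM('a))"
proof -
  let ?A = "autocorrelation f" and ?d = "DIM('a)"
  let ?G = "\<lambda>t::'a. complex_of_real (exp (- (norm (c *\<^sub>R t))\<^sup>2 / 2))"
  let ?h = "\<lambda>(z, t). ?A z * (cis (- (2 * pi * (t \<bullet> z))) * ?G t)"
  define K where "K z = complex_of_real (sqrt (2 * pi) ^ ?d / c ^ ?d * exp (- (norm ((2 * pi / c) *\<^sub>R z))\<^sup>2 / 2))" for z :: 'a
  have G: "integrable lborel (\<lambda>t. cis (- (2 * pi * (t \<bullet> z))) * ?G t)"
    "(\<integral>t. cis (- (2 * pi * (t \<bullet> z))) * ?G t \<partial>lborel) = K z" for z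
    using gaussian_fourier_scaled[OF c, of z] by (simp_all add: has_bochner_integral_iff K_def)
  have hm: "?h \<in> borel_measurable (lborel \<Otimes>\<^sub>M lborel)"
    by measurable
  \<comment> \<open>In modulus the integrand is the integrable autocorrelation in \<open>z\<close>
    times a Gaussian in \<open>t\<close>; without the Gaussian the integral over \<open>t\<close>
    would diverge.\<close>
  have int: "integrable (lborel \<Otimes>\<^sub>M lborel) ?h"
  proof (rule lborel_pair.Fubini_integrable[OF hm])
    have "integrable lborel (\<lambda>z. cmod (?A z) * (\<integral>t. cmod (?G t) \<partial>lborel))"
      by (intro integrable_mult_left integrable_norm integrable_autocorrelation)
    then show "integrable lborel (\<lambda>z. \<integral>t. norm (?h (z, t)) \<partial>lborel)"
      by (simp add: norm_mult)
    show "AE z in lborel. integrable lborel (\<lambda>t. ?h (z, t))"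
      using G(1) by (auto simp del: norm_scaleR)
  qed
  have eq: "(\<integral>z. ?h (z, t) \<partial>lborel) = complex_of_real ((cmod (fourier f t))\<^sup>2 * exp (- (norm (c *\<^sub>R t))\<^sup>2 / 2))" for t
  proof -
    have "(\<integral>z. ?h (z, t) \<partial>lborel) = (\<integral>z. cis (- (2 * pi * (t \<bullet> z))) * ?A z * ?G t \<partial>lborel)"
      by (simp add: mult_ac)
    also have "\<dots> = fourier ?A t * ?G t"
      by (simp add: fourier_def)
    finally show ?thesis
      by (simp add: fourier_autocorrelation del: norm_scaleR)
  qed
  have "integrable lborel (\<lambda>t. complex_of_real ((cmod (fourier f t))\<^sup>2 * exp (- (norm (c *\<^sub>R t))\<^sup>2 / 2)))"
    using lborel_pair.integrable_snd[of "\<lambda>z t. ?h (z, t)"] int unfolding eq by simp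
  then have 1: "integrable lborel (\<lambda>t. (cmod (fourier f t))\<^sup>2 * exp (- (norm (c *\<^sub>R t))\<^sup>2 / 2))"
    unfolding complex_of_real_integrable_eq .
  have e1: "complex_of_real (\<integral>t. (cmod (fourier f t))\<^sup>2 * exp (- (norm (c *\<^sub>R t))\<^sup>2 / 2) \<partial>lborel)
      = (\<integral>t. (\<integral>z. ?h (z, t) \<partial>lborel) \<partial>lborel)"
    unfolding eq by (subst integral_complex_of_real) (rule refl)
  have e2: "(\<integral>t. (\<integral>z. ?h (z, t) \<partial>lborel) \<partial>lborel) = (\<integral>z. (\<integral>t. ?h (z, t) \<partial>lborel) \<partial>lborel)"
    using lborel_pair.Fubini_integral[of "\<lambda>z t. ?h (z, t)"] int by simp
  have e3: "(\<integral>z. (\<integral>t. ?h (z, t) \<partial>lborel) \<partial>lborel) = (\<integral>z. ?A z * K z \<partial>lborel)"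
    using G(2) by simp
  \<comment> \<open>The substitution \<open>z = (c / (2 * pi)) *\<^sub>R w\<close> turns the
    Gaussian \<open>K\<close>, which concentrates as \<open>c\<close> tends to 0, into a fixed one
    and moves \<open>c\<close> into the argument of the autocorrelation.\<close>
  have e4: "(\<integral>z. ?A z * K z \<partial>lborel) = (\<bar>c / (2 * pi)\<bar> ^ ?d) *\<^sub>R (\<integral>w. ?A (0 + (c / (2 * pi)) *\<^sub>R w) * K (0 + (c / (2 * pi)) *\<^sub>R w) \<partial>lborel)"
  proof -
    have "integrable lborel (\<lambda>z. \<integral>t. ?h (z, t) \<partial>lborel)"
      using lborel_pair.integrable_fst[OF int] by simp
    then have "integrable lborel (\<lambda>z. ?A z * K z)"
      using G(2) by simp
    then show ?thesis
      by (rule integral_lborel_affine[of "\<lambda>z. ?A z * K z" "c / (2 * pi)" 0]) (use c in simp)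
  qed
  have e5: "(\<bar>c / (2 * pi)\<bar> ^ ?d) *\<^sub>R (\<integral>w. ?A (0 + (c / (2 * pi)) *\<^sub>R w) * K (0 + (c / (2 * pi)) *\<^sub>R w) \<partial>lborel)
      = complex_of_real (1 / sqrt (2 * pi) ^ ?d) *
        (\<integral>w. ?A ((c / (2 * pi)) *\<^sub>R w) * complex_of_real (exp (- (norm w)\<^sup>2 / 2)) \<partial>lborel)" (is "_ = _ * ?I")
  proof -
    have "\<bar>c / (2 * pi)\<bar> * (sqrt (2 * pi) / c) = 1 / sqrt (2 * pi)"
      using c by (simp add: abs_of_pos real_div_sqrt divide_simps)
    then have coeff: "\<bar>c / (2 * pi)\<bar> ^ ?d * (sqrt (2 * pi) ^ ?d / c ^ ?d) = 1 / sqrt (2 * pi) ^ ?d"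
      by (metis power_divide power_mult_distrib power_one)
    have "(\<integral>w. ?A (0 + (c / (2 * pi)) *\<^sub>R w) * K (0 + (c / (2 * pi)) *\<^sub>R w) \<partial>lborel)
        = (\<integral>w. complex_of_real (sqrt (2 * pi) ^ ?d / c ^ ?d) *
            (?A ((c / (2 * pi)) *\<^sub>R w) * complex_of_real (exp (- (norm w)\<^sup>2 / 2))) \<partial>lborel)"
    proof (intro Bochner_Integration.integral_cong refl)
      fix w :: 'a
      have "(2 * pi / c) *\<^sub>R (0 + (c / (2 * pi)) *\<^sub>R w) = w"
        unfolding add_0_left scaleR_scaleR using c by simp
      then show "?A (0 + (c / (2 * pi)) *\<^sub>R w) * K (0 + (c / (2 * pi)) *\<^sub>R w)
        = complex_of_real (sqrt (2 * pi) ^ ?d / c ^ ?d) *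
            (?A ((c / (2 * pi)) *\<^sub>R w) * complex_of_real (exp (- (norm w)\<^sup>2 / 2)))"
        by (simp only: K_def add_0_left of_real_mult mult_ac)
    qed
    also have "\<dots> = complex_of_real (sqrt (2 * pi) ^ ?d / c ^ ?d) * ?I"
      by (rule integral_mult_right_zero)
    finally show ?thesis
      by (simp only: coeff[symmetric] scaleR_conv_of_real of_real_mult mult.assoc)
  qed
  have "complex_of_real (\<integral>t. (cmod (fourier f t))\<^sup>2 * exp (- (norm (c *\<^sub>R t))\<^sup>2 / 2) \<partial>lborel)
     = complex_of_real (1 / sqrt (2 * pi) ^ ?d) *
        (\<integral>w. ?A ((c / (2 * pi)) *\<^sub>R w) * complex_of_real (exp (- (norm w)\<^sup>2 / 2)) \<partial>lborel)"
    by (rule trans[OF e1 trans[OF e2 trans[OF e3 trans[OF e4 e5]]]])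
  from arg_cong[OF this, of Re] 1 show ?thesis
    by (simp add: has_bochner_integral_iff del: norm_scaleR)
qed

lemma autocorrelation_0: "autocorrelation f 0 = complex_of_real (\<integral>x. (cmod (f x))\<^sup>2 \<partial>lborel)"
  by (simp add: autocorrelation_def complex_norm_square[symmetric] del: of_real_power)

text \<open>The integrals are nonnegative ones, so that square integrability of the transform comes
  out as a consequence.\<close>

theorem plancherel:
  "(\<integral>\<^sup>+t. ennreal ((cmod (fourier f t))\<^sup>2) \<partial>lborel) = (\<integral>\<^sup>+x. ennreal ((cmod (f x))\<^sup>2) \<partial>lborel)"
proof -
  \<comment> \<open>A decreasing null sequence makes the Gaussian factors increase to 1, so monotone
    convergence applies on the transform side, where no integrable majorant is known yet.\<close>
  define c where "c k = inverse (real (Suc k))" for k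
  have c: "c k > 0" for k by (simp add: c_def)
  have c_lim: "c \<longlonglongrightarrow> 0"
    unfolding c_def by (rule LIMSEQ_inverse_real_of_nat)
  have c_mono: "c (Suc k) \<le> c k" for k by (simp add: c_def field_simps)
  let ?F = "\<lambda>k t. (cmod (fourier f t))\<^sup>2 * exp (- (norm (c k *\<^sub>R t))\<^sup>2 / 2)"
  let ?g = "\<lambda>w::'a. complex_of_real (exp (- (norm w)\<^sup>2 / 2))"
  have g: "integrable lborel ?g" "(\<integral>w. ?g w \<partial>lborel) = complex_of_real (sqrt (2 * pi) ^ DIM('a))"
    using gaussian_fourier[of "0::'a"] by (auto simp: has_bochner_integral_iff)
  have gi: "integrable lborel (\<lambda>w. cmod (?g w))"
    using g(1) by (rule integrable_norm)
  have "(\<lambda>k. \<integral>w. autocorrelation f ((c k / (2 * pi)) *\<^sub>R w) * ?g w \<partial>lborel)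
      \<longlonglongrightarrow> (\<integral>w. autocorrelation f 0 * ?g w \<partial>lborel)"
  proof (rule integral_dominated_convergence[where w="\<lambda>w. (M * (\<integral>x. cmod (f x) \<partial>lborel)) * cmod (?g w)"])
    show "AE w in lborel. (\<lambda>k. autocorrelation f ((c k / (2 * pi)) *\<^sub>R w) * ?g w)
        \<longlonglongrightarrow> autocorrelation f 0 * ?g w"
    proof (intro AE_I2 tendsto_mult_right autocorrelation_tendsto)
      fix w :: 'a
      have "(\<lambda>k. (c k / (2 * pi)) *\<^sub>R w) \<longlonglongrightarrow> (0 / (2 * pi)) *\<^sub>R w"
        by (intro tendsto_intros c_lim) auto
      then show "(\<lambda>k. (c k / (2 * pi)) *\<^sub>R w) \<longlonglongrightarrow> 0" by simp
    qed
    show "AE w in lborel. norm (autocorrelation f ((c k / (2 * pi)) *\<^sub>R w) * ?g w)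
      \<le> (M * (\<integral>x. cmod (f x) \<partial>lborel)) * cmod (?g w)" for k
      by (intro AE_I2) (auto simp: norm_mult intro!: mult_right_mono autocorrelation_bound)
    show "integrable lborel (\<lambda>w. (M * (\<integral>x. cmod (f x) \<partial>lborel)) * cmod (?g w))"
      by (intro integrable_mult_right gi)
  qed auto
  also have "(\<integral>w. autocorrelation f 0 * ?g w \<partial>lborel) =
      complex_of_real ((\<integral>x. (cmod (f x))\<^sup>2 \<partial>lborel) * sqrt (2 * pi) ^ DIM('a))"
    by (simp only: integral_mult_right_zero g(2) autocorrelation_0 of_real_mult)
  finally have "(\<lambda>k. Re (\<integral>w. autocorrelation f ((c k / (2 * pi)) *\<^sub>R w) * ?g w \<partial>lborel) / sqrt (2 * pi) ^ DIM('a))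
      \<longlonglongrightarrow> Re (complex_of_real ((\<integral>x. (cmod (f x))\<^sup>2 \<partial>lborel) * sqrt (2 * pi) ^ DIM('a))) / sqrt (2 * pi) ^ DIM('a)"
    by (intro tendsto_divide tendsto_Re tendsto_const) auto
  then have lim: "(\<lambda>k. \<integral>t. ?F k t \<partial>lborel) \<longlonglongrightarrow> (\<integral>x. (cmod (f x))\<^sup>2 \<partial>lborel)"
    using gaussian_mean_fourier[OF c] by (simp add: has_bochner_integral_iff)
  have sq: "integrable lborel (\<lambda>x. (cmod (f x))\<^sup>2)"
    using integrable_shift_mult[of 0, THEN integrable_norm] by (simp add: norm_mult power2_eq_square)
  have "(\<lambda>k. \<integral>\<^sup>+t. ennreal (?F k t) \<partial>lborel) = (\<lambda>k. ennreal (\<integral>t. ?F k t \<partial>lborel))"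
    using gaussian_mean_fourier[OF c] by (intro ext nn_integral_eq_integral) (auto simp: has_bochner_integral_iff)
  with lim have 1: "(\<lambda>k. \<integral>\<^sup>+t. ennreal (?F k t) \<partial>lborel) \<longlonglongrightarrow> (\<integral>\<^sup>+x. ennreal ((cmod (f x))\<^sup>2) \<partial>lborel)"
    using sq by (simp add: nn_integral_eq_integral tendsto_ennrealI)
  have 2: "(\<lambda>k. \<integral>\<^sup>+t. ennreal (?F k t) \<partial>lborel) \<longlonglongrightarrow> (\<integral>\<^sup>+t. ennreal ((cmod (fourier f t))\<^sup>2) \<partial>lborel)"
  proof (rule nn_integral_LIMSEQ)
    show "incseq (\<lambda>k t. ennreal (?F k t))"
    proof (intro incseq_SucI le_funI ennreal_leI mult_left_mono)
      fix k and t :: 'a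
      have "norm (c (Suc k) *\<^sub>R t) \<le> norm (c k *\<^sub>R t)"
        using c[of k] c[of "Suc k"] c_mono[of k] by (simp add: mult_right_mono)
      then have "(norm (c (Suc k) *\<^sub>R t))\<^sup>2 \<le> (norm (c k *\<^sub>R t))\<^sup>2"
        by (rule power_mono) simp
      then show "exp (- (norm (c k *\<^sub>R t))\<^sup>2 / 2) \<le> exp (- (norm (c (Suc k) *\<^sub>R t))\<^sup>2 / 2)"
        by (simp del: norm_scaleR)
    qed simp
    fix t
    have "(\<lambda>k. ?F k t) \<longlonglongrightarrow> (cmod (fourier f t))\<^sup>2 * exp (- (norm (0 *\<^sub>R t))\<^sup>2 / 2)"
      by (intro tendsto_intros c_lim) auto
    then show "(\<lambda>k. ennreal (?F k t)) \<longlonglongrightarrow> ennreal ((cmod (fourier f t))\<^sup>2)"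
      by (intro tendsto_ennrealI) simp
  qed auto
  from LIMSEQ_unique[OF 2 1] show ?thesis .
qed

end

section \<open>Cubes and upper Beurling density\<close>

lemma mem_translate_cube: "y \<in> (+) x ` cube h \<longleftrightarrow> (\<forall>i. \<bar>y $ i - x $ i\<bar> \<le> h / 2)"
proof -
  have "y \<in> (+) x ` cube h \<longleftrightarrow> y - x \<in> cube h"
    by (force simp: image_iff)
  then show ?thesis by (simp add: cube_def)
qed

lemma translate_cube: "(+) x ` cube h = cbox (x - (\<chi> i. h / 2)) (x + (\<chi> i. h / 2))"
  unfolding set_eq_iff mem_translate_cube mem_box_cart abs_diff_le_iff by simp

lemma translate_cube_borel [measurable, simp]: "(+) x ` cube h \<in> sets borel"
  unfolding translate_cube by simp

lemma cube_borel [measurable, simp]: "cube h \<in> sets borel"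
  using translate_cube_borel[of 0 h] by simp

lemma emeasure_translate_cube:
  fixes x :: "real ^ 'n"
  assumes "h \<ge> 0"
  shows "emeasure lborel ((+) x ` cube h) = ennreal (h ^ CARD('n))"
proof -
  have b: "((\<chi> i. c) :: real ^ 'n) \<bullet> b = c" if "b \<in> Basis" for b c
    using that by (auto simp: Basis_vec_def inner_axis)
  have diff: "(x + (\<chi> i. h / 2)) - (x - (\<chi> i. h / 2)) = (\<chi> i. h)"
    by (simp add: vec_eq_iff)
  have le: "(x - (\<chi> i. h / 2)) \<bullet> b \<le> (x + (\<chi> i. h / 2)) \<bullet> b" if "b \<in> Basis" for b
    using assms by (simp add: inner_diff_left inner_add_left b[OF that])
  show ?thesis
    unfolding translate_cube by (subst emeasure_lborel_cbox[OF le]) (simp_all add: diff b)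
qed

lemma emeasure_delta_nn_integral:
  "E \<in> sets borel \<Longrightarrow> emeasure (delta \<Lambda>) E = (\<integral>\<^sup>+l. indicator E l \<partial>count_space \<Lambda>)"
  unfolding delta_def by (simp add: emeasure_sum_measure)

text \<open>Tonelli, with the substitution \<open>t = \<xi> - y\<close> for each
  \<open>\<xi>\<close>: the condition that \<open>y\<close> lies in the cube at \<open>x\<close>
  becomes the condition that \<open>\<xi>\<close> lies in the cube at \<open>x + t\<close>, and
  summing over \<open>\<xi>\<close> counts points.\<close>

lemma nn_integral_translate_sum:
  fixes P :: "real ^ 'n \<Rightarrow> ennreal"
  assumes \<Lambda>: "countable \<Lambda>" and [measurable]: "P \<in> borel_measurable borel"
  shows "(\<integral>\<^sup>+y. (\<integral>\<^sup>+\<xi>. P (\<xi> - y) \<partial>count_space \<Lambda>) * indicator ((+) x ` cube h) y \<partial>lborel)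
    = (\<integral>\<^sup>+t. P t * emeasure (delta \<Lambda>) ((+) (x + t) ` cube h) \<partial>lborel)"
proof -
  have ind: "indicator ((+) (x + t) ` cube h) \<xi> = (indicator ((+) x ` cube h) (\<xi> - t) :: ennreal)" for t \<xi>
    by (simp only: indicator_def mem_translate_cube vector_add_component vector_minus_component diff_diff_eq2 diff_diff_eq add.commute)
  have [measurable]: "(\<lambda>t. indicator ((+) (x + t) ` cube h) \<xi> :: ennreal) \<in> borel_measurable borel" for \<xi>
    unfolding ind by measurable
  have "(\<integral>\<^sup>+y. (\<integral>\<^sup>+\<xi>. P (\<xi> - y) \<partial>count_space \<Lambda>) * indicator ((+) x ` cube h) y \<partial>lborel)
      = (\<integral>\<^sup>+y. (\<integral>\<^sup>+\<xi>. P (\<xi> - y) * indicator ((+) x ` cube h) y \<partial>count_space \<Lambda>) \<partial>lborel)"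
    by (simp add: nn_integral_multc)
  also have "\<dots> = (\<integral>\<^sup>+\<xi>. (\<integral>\<^sup>+y. P (\<xi> - y) * indicator ((+) x ` cube h) y \<partial>lborel) \<partial>count_space \<Lambda>)"
    by (rule nn_integral_count_space_nn_integral[OF \<Lambda>]) measurable
  also have "\<dots> = (\<integral>\<^sup>+\<xi>. (\<integral>\<^sup>+t. P t * indicator ((+) (x + t) ` cube h) \<xi> \<partial>lborel) \<partial>count_space \<Lambda>)"
  proof (rule nn_integral_cong)
    fix \<xi>
    have "(\<integral>\<^sup>+y. P (\<xi> - y) * indicator ((+) x ` cube h) y \<partial>lborel)
        = (\<integral>\<^sup>+t. P (\<xi> - (\<xi> - t)) * indicator ((+) x ` cube h) (\<xi> - t) \<partial>lborel)"
      by (subst nn_integral_lborel_affine[of _ "-1" \<xi>]) auto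
    then show "(\<integral>\<^sup>+y. P (\<xi> - y) * indicator ((+) x ` cube h) y \<partial>lborel)
        = (\<integral>\<^sup>+t. P t * indicator ((+) (x + t) ` cube h) \<xi> \<partial>lborel)"
      by (simp add: ind)
  qed
  also have "\<dots> = (\<integral>\<^sup>+t. (\<integral>\<^sup>+\<xi>. P t * indicator ((+) (x + t) ` cube h) \<xi> \<partial>count_space \<Lambda>) \<partial>lborel)"
    by (rule nn_integral_count_space_nn_integral[OF \<Lambda>, symmetric]) measurable
  also have "\<dots> = (\<integral>\<^sup>+t. P t * emeasure (delta \<Lambda>) ((+) (x + t) ` cube h) \<partial>lborel)"
    by (simp add: nn_integral_cmult emeasure_delta_nn_integral)
  finally show ?thesis .
qed

definition density_at :: "(real ^ 'n) measure \<Rightarrow> real \<Rightarrow> ennreal" where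
  "density_at \<mu> h = (SUP x. emeasure \<mu> ((+) x ` cube h) / ennreal (h ^ CARD('n)))"

lemma upper_density_eq: "upper_density \<mu> = Limsup at_top (density_at \<mu>)"
  by (simp add: upper_density_def density_at_def[abs_def])

lemma emeasure_le_density_at:
  fixes \<mu> :: "(real ^ 'n) measure"
  assumes "h > 0"
  shows "emeasure \<mu> ((+) x ` cube h) \<le> density_at \<mu> h * ennreal (h ^ CARD('n))"
proof -
  have "emeasure \<mu> ((+) x ` cube h) = emeasure \<mu> ((+) x ` cube h) / ennreal (h ^ CARD('n)) * ennreal (h ^ CARD('n))"
    unfolding ennreal_divide_times using assms by simp
  also have "\<dots> \<le> density_at \<mu> h * ennreal (h ^ CARD('n))"
    unfolding density_at_def by (intro mult_right_mono SUP_upper) auto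
  finally show ?thesis .
qed

text \<open>\<open>cube (2 * r)\<close> has half-width \<open>r\<close>, so \<open>t\<close> moves
  each coordinate by at most \<open>r\<close>; adding \<open>2 * r\<close> to the side adds exactly
  \<open>r\<close> on each flank.\<close>

lemma translate_cube_subset:
  assumes "t \<in> cube (2 * r)"
  shows "(+) x ` cube h \<subseteq> (+) (x + t) ` cube (h + 2 * r)"
proof
  fix y assume "y \<in> (+) x ` cube h"
  then have y: "\<bar>y $ i - x $ i\<bar> \<le> h / 2" for i by (simp add: mem_translate_cube)
  have t: "\<bar>t $ i\<bar> \<le> r" for i using assms by (simp add: cube_def)
  have "\<bar>y $ i - (x + t) $ i\<bar> \<le> (h + 2 * r) / 2" for i
  proof -
    have "\<bar>(y $ i - x $ i) - t $ i\<bar> \<le> \<bar>y $ i - x $ i\<bar> + \<bar>t $ i\<bar>"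
      by (rule abs_triangle_ineq4)
    also have "\<dots> \<le> (h + 2 * r) / 2"
      using add_mono[OF y[of i] t[of i]] by simp
    finally show ?thesis by (simp add: diff_diff_eq)
  qed
  then show "y \<in> (+) (x + t) ` cube (h + 2 * r)"
    by (simp add: mem_translate_cube)
qed

lemma uminus_mem_cube: "- t \<in> cube r \<longleftrightarrow> t \<in> cube r"
  by (simp add: cube_def)

text \<open>This is the volume ratio of the cubes of side \<open>h + r\<close> and \<open>h\<close>:
  enlarging cubes by a fixed amount costs nothing in the limit.\<close>

lemma cube_ratio_tendsto: "((\<lambda>h. ennreal ((1 + r / h) ^ n)) \<longlongrightarrow> 1) at_top"
proof -
  have "((\<lambda>h. r / h) \<longlongrightarrow> 0) at_top"
    by (rule tendsto_divide_0[OF tendsto_const filterlim_at_top_imp_at_infinity[OF filterlim_ident]])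
  then have "((\<lambda>h. (1 + r / h) ^ n) \<longlongrightarrow> (1 + 0) ^ n) at_top"
    by (intro tendsto_intros)
  then have "((\<lambda>h. ennreal ((1 + r / h) ^ n)) \<longlongrightarrow> ennreal ((1 + 0) ^ n)) at_top"
    by (rule tendsto_ennrealI)
  then show ?thesis by simp
qed

lemma mem_cube_norm: "norm t \<le> r \<Longrightarrow> t \<in> cube (2 * r)"
proof -
  assume "norm t \<le> r"
  then have "\<bar>t $ i\<bar> \<le> r" for i
    using component_le_norm_cart[of t i] by linarith
  then show ?thesis by (simp add: cube_def)
qed

lemma SUP_cube: "(SUP k. P * indicator (cube (2 * real k)) t :: ennreal) = P"
proof (rule antisym)
  obtain k where "norm t \<le> real k"
    using real_arch_simple by blast
  then have "P = P * indicator (cube (2 * real k)) t"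
    by (simp add: mem_cube_norm)
  also have "\<dots> \<le> (SUP k. P * indicator (cube (2 * real k)) t)"
    by (rule SUP_upper) simp
  finally show "P \<le> (SUP k. P * indicator (cube (2 * real k)) t)" .
  show "(SUP k. P * indicator (cube (2 * real k)) t) \<le> P"
    by (rule SUP_least) (simp add: indicator_def)
qed

lemma cube_mono:
  assumes "a \<le> b"
  shows "cube a \<subseteq> cube b"
proof
  fix t assume "t \<in> cube a"
  then have "\<bar>t $ i\<bar> \<le> a / 2" for i
    by (simp add: cube_def)
  moreover have "a / 2 \<le> b / 2"
    using assms by simp
  ultimately have "\<bar>t $ i\<bar> \<le> b / 2" for i
    by (rule order_trans)
  then show "t \<in> cube b"
    by (simp add: cube_def)
qed

section \<open>From averaged inequalities to upper densities\<close>

text \<open>For \<open>t\<close> in \<open>cube (2 * r)\<close> the enlarged cube at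
  \<open>x + t\<close> contains the cube of side \<open>h\<close> at \<open>x\<close>, so the
  hypothesis at side \<open>h + 2 * r\<close> bounds the measure of the smaller cube times the mass
  of \<open>P\<close> on \<open>cube (2 * r)\<close>. Dividing by the volume, \<open>h\<close> and
  then \<open>r\<close> tend to infinity.\<close>

lemma upper_density_mult_le:
  fixes P :: "real ^ 'n \<Rightarrow> ennreal"
  assumes [measurable]: "P \<in> borel_measurable borel" and sets: "sets \<mu> = sets borel" and C: "C < \<infinity>"
    and le: "\<And>x h. h > 0 \<Longrightarrow> (\<integral>\<^sup>+t. P t * emeasure \<mu> ((+) (x + t) ` cube h) \<partial>lborel) \<le> C * ennreal (h ^ CARD('n))"
  shows "upper_density \<mu> * (\<integral>\<^sup>+t. P t \<partial>lborel) \<le> C"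
proof -
  have step: "upper_density \<mu> * (\<integral>\<^sup>+t. P t * indicator (cube (2 * r)) t \<partial>lborel) \<le> C" if r: "r \<ge> 0" for r
  proof -
    define I where "I = (\<integral>\<^sup>+t. P t * indicator (cube (2 * r)) t \<partial>lborel)"
    have bound: "density_at \<mu> h * I \<le> C * ennreal ((1 + 2 * r / h) ^ CARD('n))" if h: "h > 0" for h
    proof -
      have "emeasure \<mu> ((+) x ` cube h) / ennreal (h ^ CARD('n)) * I \<le> C * ennreal ((1 + 2 * r / h) ^ CARD('n))" for x
      proof -
        have "emeasure \<mu> ((+) x ` cube h) * I
            = (\<integral>\<^sup>+t. emeasure \<mu> ((+) x ` cube h) * (P t * indicator (cube (2 * r)) t) \<partial>lborel)"
          unfolding I_def by (simp add: nn_integral_cmult)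
        also have "\<dots> \<le> (\<integral>\<^sup>+t. P t * emeasure \<mu> ((+) (x + t) ` cube (h + 2 * r)) \<partial>lborel)"
        proof (intro nn_integral_mono)
          fix t
          have "emeasure \<mu> ((+) x ` cube h) \<le> emeasure \<mu> ((+) (x + t) ` cube (h + 2 * r))" if "t \<in> cube (2 * r)"
            using translate_cube_subset[OF that] by (intro emeasure_mono) (auto simp: sets)
          then show "emeasure \<mu> ((+) x ` cube h) * (P t * indicator (cube (2 * r)) t)
              \<le> P t * emeasure \<mu> ((+) (x + t) ` cube (h + 2 * r))"
            by (cases "t \<in> cube (2 * r)") (simp_all add: mult.commute[of "P t"] mult_right_mono)
        qed
        also have "\<dots> \<le> C * ennreal ((h + 2 * r) ^ CARD('n))"
          using h r by (intro le) simp
        finally have "emeasure \<mu> ((+) x ` cube h) * I / ennreal (h ^ CARD('n))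
            \<le> C * ennreal ((h + 2 * r) ^ CARD('n)) / ennreal (h ^ CARD('n))"
          by (rule divide_right_mono_ennreal)
        also have "\<dots> = C * ennreal ((1 + 2 * r / h) ^ CARD('n))"
        proof -
          have "(h + 2 * r) ^ CARD('n) / h ^ CARD('n) = (1 + 2 * r / h) ^ CARD('n)"
            using h by (simp only: power_divide[symmetric]) (simp add: add_divide_distrib)
          then show ?thesis
            using h r unfolding ennreal_times_divide[symmetric] by (subst divide_ennreal) auto
        qed
        finally show ?thesis
          by (simp only: ennreal_divide_times ennreal_times_divide)
      qed
      then show ?thesis
        unfolding density_at_def SUP_mult_right_ennreal by (rule SUP_least)
    qed
    \<comment> \<open>The right side of \<open>bound\<close> decreases in \<open>h\<close>, so its
      value at \<open>H\<close> bounds the supremum over all \<open>h\<close> beyond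
      \<open>H\<close>, and that supremum bounds the limsup.\<close>
    have ev: "upper_density \<mu> * I \<le> C * ennreal ((1 + 2 * r / H) ^ CARD('n))" if H: "H > 0" for H
    proof -
      have "upper_density \<mu> \<le> (SUP h\<in>{H..}. density_at \<mu> h)"
        unfolding upper_density_eq
        by (intro Limsup_bounded eventually_mono[OF eventually_ge_at_top[of H]] SUP_upper) simp
      then have "upper_density \<mu> * I \<le> (SUP h\<in>{H..}. density_at \<mu> h) * I"
        by (rule mult_right_mono) simp
      also have "\<dots> = (SUP h\<in>{H..}. density_at \<mu> h * I)"
        by (rule SUP_mult_right_ennreal)
      also have "\<dots> \<le> C * ennreal ((1 + 2 * r / H) ^ CARD('n))"
      proof (rule SUP_least)
        fix h assume "h \<in> {H..}"
        then have h: "h > 0" "H \<le> h" using H by auto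
        have "(1 + 2 * r / h) ^ CARD('n) \<le> (1 + 2 * r / H) ^ CARD('n)"
          using h H r by (intro power_mono add_left_mono divide_left_mono) auto
        then have "C * ennreal ((1 + 2 * r / h) ^ CARD('n)) \<le> C * ennreal ((1 + 2 * r / H) ^ CARD('n))"
          by (intro mult_left_mono ennreal_leI) auto
        with bound[OF h(1)] show "density_at \<mu> h * I \<le> C * ennreal ((1 + 2 * r / H) ^ CARD('n))"
          by (rule order_trans)
      qed
      finally show ?thesis .
    qed
    have lim: "((\<lambda>H. C * ennreal ((1 + 2 * r / H) ^ CARD('n))) \<longlongrightarrow> C * 1) at_top"
      using C by (intro ennreal_tendsto_cmult cube_ratio_tendsto) simp
    have "upper_density \<mu> * I \<le> C * 1"
      by (rule tendsto_lowerbound[OF lim eventually_mono[OF eventually_gt_at_top[of 0] ev]]) simp_all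
    then show ?thesis by (simp add: I_def)
  qed
  \<comment> \<open>Monotone convergence along growing cubes recovers the full mass of
    \<open>P\<close>.\<close>
  have "(\<integral>\<^sup>+t. P t \<partial>lborel) = (\<integral>\<^sup>+t. (SUP k. P t * indicator (cube (2 * real k)) t) \<partial>lborel)"
    by (intro nn_integral_cong SUP_cube[symmetric])
  also have "\<dots> = (SUP k. \<integral>\<^sup>+t. P t * indicator (cube (2 * real k)) t \<partial>lborel)"
  proof (rule nn_integral_monotone_convergence_SUP)
    show "incseq (\<lambda>k t. P t * indicator (cube (2 * real k)) t)"
    proof (intro incseq_SucI le_funI mult_left_mono)
      fix k and t :: "real ^ 'n"
      show "indicator (cube (2 * real k)) t \<le> (indicator (cube (2 * real (Suc k))) t :: ennreal)"
        using cube_mono[of "2 * real k" "2 * real (Suc k)"] by (auto simp: indicator_def)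
    qed simp
  qed measurable
  finally show ?thesis
    using step by (auto simp: SUP_mult_left_ennreal intro!: SUP_least)
qed

lemma nn_integral_outside_cube_tendsto:
  assumes [measurable]: "P \<in> borel_measurable borel" and fin: "(\<integral>\<^sup>+t. P t \<partial>lborel) < \<infinity>"
  shows "(\<lambda>k. \<integral>\<^sup>+t. P t * indicator (- cube (2 * real k)) t \<partial>lborel) \<longlonglongrightarrow> 0"
proof -
  have "(\<lambda>k. \<integral>\<^sup>+t. P t * indicator (- cube (2 * real k)) t \<partial>lborel) \<longlonglongrightarrow> (\<integral>\<^sup>+t. 0 \<partial>(lborel :: (real ^ 'a) measure))"
  proof (rule nn_integral_dominated_convergence[where w=P])
    show "AE t in lborel. (\<lambda>k. P t * indicator (- cube (2 * real k)) t) \<longlonglongrightarrow> 0"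
    proof (intro AE_I2 tendsto_eventually)
      fix t :: "real ^ 'a"
      obtain k0 where k0: "norm t \<le> real k0"
        using real_arch_simple by blast
      show "\<forall>\<^sub>F k in sequentially. P t * indicator (- cube (2 * real k)) t = 0"
      proof (rule eventually_mono[OF eventually_ge_at_top[of k0]])
        fix k assume "k0 \<le> k"
        with k0 have "norm t \<le> real k" by simp
        then have "t \<in> cube (2 * real k)"
          by (rule mem_cube_norm)
        then show "P t * indicator (- cube (2 * real k)) t = 0" by simp
      qed
    qed
    show "AE t in lborel. P t * indicator (- cube (2 * real k)) t \<le> P t" for k
      by (auto simp: indicator_def)
  qed (use fin in auto)
  then show ?thesis by simp
qed

text \<open>
  All cubes \<open>t + Q\<^sub>h\<close> with \<open>t \<in> Q\<^sub>2\<^sub>k\<close> lie in the single cube \<open>Q\<close> of side \<open>h + 2k\<close>.  Bounding the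
  counts at the same \<open>Q\<close> for all \<open>j \<in> J'\<close> yields the density of the sum of the measures, which
  may be smaller than the sum of their densities.
\<close>

lemma le_upper_density_mult:
  fixes P :: "'i \<Rightarrow> real ^ 'n \<Rightarrow> ennreal" and \<mu> :: "'i \<Rightarrow> (real ^ 'n) measure" and J J' :: "'i set"
  defines "D \<equiv> upper_density (sum_measure J' \<mu>)"
  assumes J: "finite J" "J' \<subseteq> J"
    and P [measurable]: "\<And>j. P j \<in> borel_measurable borel"
    and P_fin: "\<And>j. j \<in> J \<Longrightarrow> (\<integral>\<^sup>+t. P j t \<partial>lborel) < \<infinity>"
    and P_le: "\<And>j. j \<in> J' \<Longrightarrow> (\<integral>\<^sup>+t. P j t \<partial>lborel) \<le> p" and p: "p < \<infinity>"
    and sets: "\<And>j. sets (\<mu> j) = sets borel"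
    and zero: "\<And>j. j \<in> J - J' \<Longrightarrow> upper_density (\<mu> j) = 0"
    and D: "D < \<infinity>"
    and le: "\<And>h. h > 0 \<Longrightarrow> L * ennreal (h ^ CARD('n)) \<le> (\<Sum>j\<in>J. \<integral>\<^sup>+t. P j t * emeasure (\<mu> j) ((+) t ` cube h) \<partial>lborel)"
  shows "L \<le> D * p"
proof -
  define N where "N = sum_measure J' \<mu>"
  \<comment> \<open>\<open>e k\<close> is the slack granted to all densities: \<open>v k\<close>
    lies strictly above \<open>D\<close>, and \<open>e k\<close> strictly above the zero densities
    outside \<open>J'\<close>. The same \<open>k\<close> sets the cube outside which
    \<open>T k\<close> is the remaining mass. \<open>W\<close> is finite and occurs only with the
    factor \<open>e k\<close>.\<close>
  define e where "e k = ennreal (inverse (real (Suc k)))" for k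
  define v where "v k = D + e k" for k
  define T where "T k = (\<Sum>j\<in>J'. \<integral>\<^sup>+t. P j t * indicator (- cube (2 * real k)) t \<partial>lborel)" for k
  define W where "W = (\<Sum>j\<in>J - J'. \<integral>\<^sup>+t. P j t \<partial>lborel)"
  have J': "finite J'" using J finite_subset by blast
  have W: "W < \<infinity>"
    unfolding W_def using J P_fin by (auto simp: less_top[symmetric])
  have e: "0 < e k" "e k < \<infinity>" for k by (auto simp: e_def)
  have v: "D < v k" "v k < \<infinity>" for k
    using D e[of k] by (auto simp: v_def ennreal_add_left_cancel_less less_top[symmetric])
  have N_eq: "emeasure N E = (\<Sum>j\<in>J'. emeasure (\<mu> j) E)" if "E \<in> sets borel" for E
    unfolding N_def using J' sets that by (rule emeasure_sum_measure_finite)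
  \<comment> \<open>Three contributions: windows in \<open>J'\<close> near the origin give the main
    term, their tails give \<open>v k * T k\<close>, and the windows outside \<open>J'\<close> give
    \<open>e k * W\<close>.\<close>
  have bound: "L \<le> v k * p * ennreal ((1 + 2 * real k / h) ^ CARD('n)) + (v k * T k + e k * W)"
    if h: "h > 0" and d1: "density_at N h < v k" and d2: "density_at N (h + 2 * real k) < v k"
      and d3: "\<And>j. j \<in> J - J' \<Longrightarrow> density_at (\<mu> j) h < e k" for h k
  proof -
    define hn where "hn = ennreal (h ^ CARD('n))"
    have hn: "hn \<noteq> 0" "hn \<noteq> top" using h by (auto simp: hn_def)
    let ?Q = "(+) 0 ` cube (h + 2 * real k) :: (real ^ 'n) set"
    have 1: "(\<integral>\<^sup>+t. P j t * emeasure (\<mu> j) ((+) t ` cube h) \<partial>lborel)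
        \<le> emeasure (\<mu> j) ?Q * p + v k * hn * (\<integral>\<^sup>+t. P j t * indicator (- cube (2 * real k)) t \<partial>lborel)"
      if j: "j \<in> J'" for j
    proof -
      have "(\<integral>\<^sup>+t. P j t * emeasure (\<mu> j) ((+) t ` cube h) \<partial>lborel)
          \<le> (\<integral>\<^sup>+t. emeasure (\<mu> j) ?Q * P j t + v k * hn * (P j t * indicator (- cube (2 * real k)) t) \<partial>lborel)"
      proof (rule nn_integral_mono)
        fix t
        show "P j t * emeasure (\<mu> j) ((+) t ` cube h)
            \<le> emeasure (\<mu> j) ?Q * P j t + v k * hn * (P j t * indicator (- cube (2 * real k)) t)"
        proof (cases "t \<in> cube (2 * real k)")
          case True
          \<comment> \<open>The inclusion goes from the cube at \<open>t\<close> back to the origin,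
            hence the shift \<open>- t\<close>; \<open>cube\<close> is symmetric.\<close>
          then have "(+) t ` cube h \<subseteq> ?Q"
            using translate_cube_subset[of "- t" "real k" t h] by (simp add: uminus_mem_cube)
          then have "emeasure (\<mu> j) ((+) t ` cube h) \<le> emeasure (\<mu> j) ?Q"
            by (rule emeasure_mono) (simp only: sets translate_cube_borel)
          then have "P j t * emeasure (\<mu> j) ((+) t ` cube h) \<le> P j t * emeasure (\<mu> j) ?Q"
            by (rule mult_left_mono) simp
          also have "\<dots> \<le> emeasure (\<mu> j) ?Q * P j t + v k * hn * (P j t * indicator (- cube (2 * real k)) t)"
            by (simp only: mult.commute[of "P j t" "emeasure (\<mu> j) ?Q"] le_iff_add) blast
          finally show ?thesis .
        next
          case False
          \<comment> \<open>Far from the origin a crude bound is enough: one measure is at most the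
            sum \<open>N\<close>, whose density at side \<open>h\<close> is below \<open>v k\<close>
            at every position.\<close>
          have "emeasure (\<mu> j) ((+) t ` cube h) \<le> (\<Sum>j\<in>J'. emeasure (\<mu> j) ((+) t ` cube h))"
            using J' j by (intro member_le_sum) auto
          also have "\<dots> = emeasure N ((+) t ` cube h)"
            by (simp add: N_eq)
          also have "\<dots> \<le> density_at N h * hn"
            unfolding hn_def by (rule emeasure_le_density_at[OF h])
          also have "\<dots> \<le> v k * hn"
            using d1 by (intro mult_right_mono) auto
          finally have "P j t * emeasure (\<mu> j) ((+) t ` cube h) \<le> P j t * (v k * hn)"
            by (rule mult_left_mono) simp
          also have "\<dots> = v k * hn * (P j t * indicator (- cube (2 * real k)) t)"
            using False by (simp add: mult_ac)
          also have "\<dots> \<le> emeasure (\<mu> j) ?Q * P j t + v k * hn * (P j t * indicator (- cube (2 * real k)) t)"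
            by (rule add_increasing) simp_all
          finally show ?thesis .
        qed
      qed
      also have "\<dots> = emeasure (\<mu> j) ?Q * (\<integral>\<^sup>+t. P j t \<partial>lborel)
          + v k * hn * (\<integral>\<^sup>+t. P j t * indicator (- cube (2 * real k)) t \<partial>lborel)"
        by (subst nn_integral_add) (auto simp: nn_integral_cmult)
      also have "\<dots> \<le> emeasure (\<mu> j) ?Q * p
          + v k * hn * (\<integral>\<^sup>+t. P j t * indicator (- cube (2 * real k)) t \<partial>lborel)"
        using P_le[OF j] by (intro add_right_mono mult_left_mono) auto
      finally show ?thesis .
    qed
    have 2: "(\<integral>\<^sup>+t. P j t * emeasure (\<mu> j) ((+) t ` cube h) \<partial>lborel) \<le> e k * hn * (\<integral>\<^sup>+t. P j t \<partial>lborel)"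
      if j: "j \<in> J - J'" for j
    proof -
      have "emeasure (\<mu> j) ((+) t ` cube h) \<le> e k * hn" for t
      proof -
        have "emeasure (\<mu> j) ((+) t ` cube h) \<le> density_at (\<mu> j) h * hn"
          unfolding hn_def by (rule emeasure_le_density_at[OF h])
        also have "\<dots> \<le> e k * hn"
          using d3[OF j] by (intro mult_right_mono) auto
        finally show ?thesis .
      qed
      then have "(\<integral>\<^sup>+t. P j t * emeasure (\<mu> j) ((+) t ` cube h) \<partial>lborel) \<le> (\<integral>\<^sup>+t. P j t * (e k * hn) \<partial>lborel)"
        by (intro nn_integral_mono mult_left_mono) auto
      also have "\<dots> = e k * hn * (\<integral>\<^sup>+t. P j t \<partial>lborel)"
        by (simp add: nn_integral_multc mult.commute)
      finally show ?thesis .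
    qed
    have Q: "(\<Sum>j\<in>J'. emeasure (\<mu> j) ?Q) \<le> v k * (ennreal ((1 + 2 * real k / h) ^ CARD('n)) * hn)"
    proof -
      have "(\<Sum>j\<in>J'. emeasure (\<mu> j) ?Q) = emeasure N ?Q"
        by (rule N_eq[symmetric]) (rule translate_cube_borel)
      also have "\<dots> \<le> density_at N (h + 2 * real k) * ennreal ((h + 2 * real k) ^ CARD('n))"
        using h by (intro emeasure_le_density_at) simp
      also have "\<dots> \<le> v k * ennreal ((h + 2 * real k) ^ CARD('n))"
        using d2 by (intro mult_right_mono) auto
      also have "(h + 2 * real k) ^ CARD('n) = (1 + 2 * real k / h) ^ CARD('n) * h ^ CARD('n)"
        using h by (simp only: power_mult_distrib[symmetric]) (simp add: distrib_right)
      finally show ?thesis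
        using h by (simp add: hn_def ennreal_mult)
    qed
    \<comment> \<open>The volume \<open>hn\<close> is carried as a factor and cancelled at the end,
      as it is neither 0 nor infinite.\<close>
    have "hn * L \<le> (\<Sum>j\<in>J. \<integral>\<^sup>+t. P j t * emeasure (\<mu> j) ((+) t ` cube h) \<partial>lborel)"
      using le[OF h] by (simp only: hn_def mult.commute)
    also have "\<dots> = (\<Sum>j\<in>J'. \<integral>\<^sup>+t. P j t * emeasure (\<mu> j) ((+) t ` cube h) \<partial>lborel)
        + (\<Sum>j\<in>J - J'. \<integral>\<^sup>+t. P j t * emeasure (\<mu> j) ((+) t ` cube h) \<partial>lborel)"
      using J by (subst sum.subset_diff[of J']) (auto simp: add.commute)
    also have "\<dots> \<le> (\<Sum>j\<in>J'. emeasure (\<mu> j) ?Q * p + v k * hn * (\<integral>\<^sup>+t. P j t * indicator (- cube (2 * real k)) t \<partial>lborel))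
        + (\<Sum>j\<in>J - J'. e k * hn * (\<integral>\<^sup>+t. P j t \<partial>lborel))"
      using 1 2 by (intro add_mono sum_mono) auto
    also have "\<dots> = (\<Sum>j\<in>J'. emeasure (\<mu> j) ?Q) * p + v k * hn * T k + e k * hn * W"
      by (simp only: sum.distrib sum_distrib_left sum_distrib_right T_def W_def)
    also have "\<dots> \<le> v k * (ennreal ((1 + 2 * real k / h) ^ CARD('n)) * hn) * p + v k * hn * T k + e k * hn * W"
      using Q by (intro add_right_mono mult_right_mono) auto
    also have "\<dots> = hn * (v k * p * ennreal ((1 + 2 * real k / h) ^ CARD('n)) + (v k * T k + e k * W))"
      by (simp only: distrib_left mult_ac add_ac)
    finally show ?thesis
      using hn by (simp only: ennreal_mult_le_mult_iff simp_thms)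
  qed
  have step: "L \<le> v k * p + (v k * T k + e k * W)" for k
  proof -
    have "eventually (\<lambda>h. density_at N h < v k) at_top"
      using v(1)[of k] unfolding D_def upper_density_eq N_def by (rule Limsup_lessD)
    \<comment> \<open>An explicit threshold, because \<open>bound\<close> uses the density of
      \<open>N\<close> both at \<open>h\<close> and at \<open>h + 2 * real k\<close>.\<close>
    then obtain H where H: "\<And>h. h \<ge> H \<Longrightarrow> density_at N h < v k"
      by (auto simp: eventually_at_top_linorder)
    have "eventually (\<lambda>h. \<forall>j\<in>J - J'. density_at (\<mu> j) h < e k) at_top"
    proof (rule eventually_ball_finite)
      show "\<forall>j\<in>J - J'. eventually (\<lambda>h. density_at (\<mu> j) h < e k) at_top"
        using zero e(1)[of k] by (auto simp: upper_density_eq intro!: Limsup_lessD)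
    qed (use J in simp)
    moreover have "eventually (\<lambda>h::real. h > 0 \<and> h \<ge> H) at_top"
      by (intro eventually_conj eventually_gt_at_top eventually_ge_at_top)
    ultimately have ev: "eventually (\<lambda>h. L \<le> v k * p * ennreal ((1 + 2 * real k / h) ^ CARD('n)) + (v k * T k + e k * W)) at_top"
    proof eventually_elim
      case (elim h)
      then show ?case by (intro bound H) auto
    qed
    \<comment> \<open>With \<open>k\<close> fixed, letting \<open>h\<close> grow removes the volume
      ratio; only afterwards does \<open>k\<close> tend to infinity.\<close>
    have "((\<lambda>h. v k * p * ennreal ((1 + 2 * real k / h) ^ CARD('n)) + (v k * T k + e k * W))
        \<longlongrightarrow> v k * p * 1 + (v k * T k + e k * W)) at_top"
      using v[of k] p by (intro tendsto_add tendsto_const ennreal_tendsto_cmult cube_ratio_tendsto)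
        (simp add: ennreal_mult_less_top)
    from tendsto_lowerbound[OF this ev] show ?thesis by simp
  qed
  have e_lim: "e \<longlonglongrightarrow> 0"
    unfolding e_def using tendsto_ennrealI[OF LIMSEQ_inverse_real_of_nat] by simp
  have v_lim: "v \<longlonglongrightarrow> D"
    unfolding v_def using tendsto_add[OF tendsto_const e_lim, of D] by simp
  have T_lim: "T \<longlonglongrightarrow> 0"
  proof -
    have "T \<longlonglongrightarrow> (\<Sum>j\<in>J'. 0)"
      unfolding T_def using J P_fin by (intro tendsto_sum nn_integral_outside_cube_tendsto) auto
    then show ?thesis by simp
  qed
  \<comment> \<open>Finiteness of \<open>D\<close>, \<open>p\<close> and \<open>W\<close> excludes
    products of 0 with infinity in these limits.\<close>
  have "(\<lambda>k. v k * p + (v k * T k + e k * W)) \<longlonglongrightarrow> D * p + (D * 0 + 0 * W)"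
    using D p W by (intro tendsto_add tendsto_mult_ennreal v_lim T_lim e_lim tendsto_const) auto
  from tendsto_lowerbound[OF this always_eventually[OF allI[OF step]]] show ?thesis
    by simp
qed

text \<open>Turns the sums of \<open>analysis_sum\<close> into integrals, to which Tonelli applies.
  The harder inequality exhausts \<open>A\<close> by increasing finite sets and uses monotone
  convergence.\<close>

lemma infsum_ennreal_count_space:
  fixes f :: "'a \<Rightarrow> ennreal"
  assumes A: "countable A"
  shows "infsum f A = (\<integral>\<^sup>+x. f x \<partial>count_space A)"
proof (rule antisym)
  have eq: "infsum f A = (SUP F\<in>{F. finite F \<and> F \<subseteq> A}. sum f F)"
    by (rule nonneg_infsum_complete) simp
  have fin: "sum f F = (\<integral>\<^sup>+x. f x * indicator F x \<partial>count_space A)" if "finite F" "F \<subseteq> A" for F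
  proof -
    have "(\<integral>\<^sup>+x. f x * indicator F x \<partial>count_space A) = (\<Sum>x\<in>F. f x * indicator F x)"
      using that by (intro nn_integral_count_space') auto
    also have "\<dots> = sum f F"
      by (rule sum.cong) auto
    finally show ?thesis ..
  qed
  show "infsum f A \<le> (\<integral>\<^sup>+x. f x \<partial>count_space A)"
    unfolding eq
  proof (rule SUP_least)
    fix F assume "F \<in> {F. finite F \<and> F \<subseteq> A}"
    then have "sum f F = (\<integral>\<^sup>+x. f x * indicator F x \<partial>count_space A)"
      using fin by auto
    also have "\<dots> \<le> (\<integral>\<^sup>+x. f x \<partial>count_space A)"
      by (rule nn_integral_mono) (simp add: indicator_def)
    finally show "sum f F \<le> (\<integral>\<^sup>+x. f x \<partial>count_space A)" .
  qed
  \<comment> \<open>For empty \<open>A\<close> the values of \<open>from_nat_into A\<close> are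
    arbitrary; the intersection discards them.\<close>
  define F where "F n = A \<inter> from_nat_into A ` {..n}" for n :: nat
  have F: "finite (F n)" "F n \<subseteq> A" for n by (auto simp: F_def)
  have mono: "F m \<subseteq> F n" if "m \<le> n" for m n
    using that by (auto simp: F_def)
  have "(\<integral>\<^sup>+x. f x \<partial>count_space A) = (\<integral>\<^sup>+x. (SUP n. f x * indicator (F n) x) \<partial>count_space A)"
  proof (rule nn_integral_cong)
    fix x assume "x \<in> space (count_space A)"
    then have "x \<in> F (to_nat_on A x)"
      using A by (auto simp: F_def intro!: rev_image_eqI[of "to_nat_on A x"])
    then have "f x \<le> (SUP n. f x * indicator (F n) x)"
      by (intro SUP_upper2[of "to_nat_on A x"]) auto
    moreover have "(SUP n. f x * indicator (F n) x) \<le> f x"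
      by (rule SUP_least) (simp add: indicator_def)
    ultimately show "f x = (SUP n. f x * indicator (F n) x)"
      by (rule antisym)
  qed
  also have "\<dots> = (SUP n. \<integral>\<^sup>+x. f x * indicator (F n) x \<partial>count_space A)"
  proof (rule nn_integral_monotone_convergence_SUP)
    show "incseq (\<lambda>n x. f x * indicator (F n) x)"
    proof (intro incseq_SucI le_funI mult_left_mono)
      fix n x
      show "indicator (F n) x \<le> (indicator (F (Suc n)) x :: ennreal)"
        using mono[of n "Suc n"] by (auto simp: indicator_def)
    qed simp
  qed simp
  also have "\<dots> \<le> infsum f A"
    unfolding eq using F by (intro SUP_least) (auto simp: fin[symmetric] intro!: SUP_upper)
  finally show "(\<integral>\<^sup>+x. f x \<partial>count_space A) \<le> infsum f A" .
qed

section \<open>Coefficients of modulated indicators\<close>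

lemma lebesgue_measurable_borel: "f \<in> borel_measurable borel \<Longrightarrow> f \<in> borel_measurable (lebesgue_on \<Omega>)"
  for f :: "'a::euclidean_space \<Rightarrow> 'b::topological_space"
  by (intro measurable_restrict_space1 measurable_completion) simp

definition modulated_indicator :: "(real ^ 'n) set \<Rightarrow> real ^ 'n \<Rightarrow> real ^ 'n \<Rightarrow> complex" where
  "modulated_indicator E y x = indicator E x * cis (2 * pi * (y \<bullet> x))"

lemma modulated_indicator_L2:
  assumes \<Omega>: "\<Omega> \<in> sets lebesgue" "emeasure lebesgue \<Omega> < \<infinity>" and E: "E \<in> sets lebesgue" "E \<subseteq> \<Omega>"
  shows "modulated_indicator E y \<in> L2 \<Omega>"
    and "L2_norm_sq \<Omega> (modulated_indicator E y) = measure lebesgue E"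
proof -
  have E': "E \<in> sets (lebesgue_on \<Omega>)"
    using \<Omega> E by (simp add: sets_restrict_space_iff)
  have sq: "(cmod (modulated_indicator E y x))\<^sup>2 = indicator E x" for x
    by (simp add: modulated_indicator_def norm_mult indicator_def)
  have em: "emeasure (lebesgue_on \<Omega>) E = emeasure lebesgue E" "measure (lebesgue_on \<Omega>) E = measure lebesgue E"
    using \<Omega> E by (simp_all add: emeasure_restrict_space measure_restrict_space)
  have "emeasure lebesgue E < \<infinity>"
    using emeasure_mono[OF E(2) \<Omega>(1)] \<Omega>(2) by simp
  then have int: "integrable (lebesgue_on \<Omega>) (\<lambda>x. indicator E x :: real)"
    using E' em by (intro integrable_real_indicator) auto
  have "(\<lambda>x. cis (2 * pi * (y \<bullet> x))) \<in> borel_measurable (lebesgue_on \<Omega>)"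
    by (intro lebesgue_measurable_borel) measurable
  then have "modulated_indicator E y \<in> borel_measurable (lebesgue_on \<Omega>)"
    unfolding modulated_indicator_def[abs_def] using E' by (intro borel_measurable_times borel_measurable_indicator)
  with int show "modulated_indicator E y \<in> L2 \<Omega>"
    by (simp add: L2_def sq)
  show "L2_norm_sq \<Omega> (modulated_indicator E y) = measure lebesgue E"
    using E' E(2) em by (simp add: L2_norm_sq_def sq Int_absorb2)
qed

text \<open>Modulating by \<open>y\<close> only shifts the frequency, so one function
  \<open>\<phi>\<close> serves all \<open>y\<close> and \<open>\<xi>\<close>. It is a Borel
  representative of the indicator of \<open>E\<close> times the conjugate of \<open>g\<close>, since
  \<open>g\<close> is only Lebesgue measurable while the Fourier part works with Borel
  functions.\<close>

lemma windowed_fourier: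
  fixes g :: "real ^ 'n \<Rightarrow> complex"
  assumes \<Omega>: "\<Omega> \<in> sets lebesgue" and g: "g \<in> borel_measurable (lebesgue_on \<Omega>)"
    and E: "E \<in> sets lebesgue" "E \<subseteq> \<Omega>"
    and bound: "\<And>x. x \<in> E \<Longrightarrow> cmod (g x) \<le> M" and r: "\<And>x. x \<in> E \<Longrightarrow> norm x \<le> r" and M: "0 \<le> M"
  obtains \<phi> where "bounded_support \<phi> M r"
    and "\<And>y \<xi>. L2_inner \<Omega> (modulated_indicator E y) (windowed_exp g \<xi>) = fourier \<phi> (\<xi> - y)"
    and "(\<integral>\<^sup>+x. ennreal ((cmod (\<phi> x))\<^sup>2) \<partial>lborel) = (\<integral>\<^sup>+x. ennreal ((cmod (g x))\<^sup>2) * indicator E x \<partial>lebesgue)"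
proof -
  \<comment> \<open>Outside \<open>\<Omega>\<close> the values of \<open>g\<close> are
    unconstrained, so \<open>g\<close> is set to 0 there before measurability on the whole space is
    claimed.\<close>
  define \<psi> where "\<psi> x = indicator E x * cnj (if x \<in> \<Omega> then g x else 0)" for x
  have [measurable]: "(\<lambda>x. if x \<in> \<Omega> then g x else 0) \<in> borel_measurable lebesgue"
    using g by (simp add: borel_measurable_if[OF \<Omega>])
  have \<psi>m [measurable]: "\<psi> \<in> borel_measurable lebesgue"
    unfolding \<psi>_def[abs_def] using E(1) by measurable
  have \<psi>_eq: "\<psi> x = indicator E x * cnj (g x)" for x
    using E(2) by (auto simp: \<psi>_def indicator_def)
  obtain a where a [measurable]: "a \<in> borel_measurable lborel" and a_eq: "AE x in lborel. Re (\<psi> x) = a x"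
    using completion_ex_borel_measurable_real[of "\<lambda>x. Re (\<psi> x)" lborel] by auto
  obtain b where b [measurable]: "b \<in> borel_measurable lborel" and b_eq: "AE x in lborel. Im (\<psi> x) = b x"
    using completion_ex_borel_measurable_real[of "\<lambda>x. Im (\<psi> x)" lborel] by auto
  define \<phi>' where "\<phi>' x = complex_of_real (a x) + \<i> * complex_of_real (b x)" for x
  have [measurable]: "\<phi>' \<in> borel_measurable borel"
    unfolding \<phi>'_def[abs_def] using a b by simp
  \<comment> \<open>The Borel representative may violate the bounds on a null set; this truncation
    restores them everywhere and changes nothing almost everywhere.\<close>
  define \<phi> where "\<phi> x = (if norm x \<le> r \<and> cmod (\<phi>' x) \<le> M then \<phi>' x else 0)" for x
  have \<phi>m [measurable]: "\<phi> \<in> borel_measurable borel"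
    unfolding \<phi>_def[abs_def] by measurable
  have \<phi>_bs: "bounded_support \<phi> M r"
    by standard (use M in \<open>auto simp: \<phi>_def\<close>)
  have "AE x in lborel. \<psi> x = \<phi> x"
    using a_eq b_eq
  proof eventually_elim
    case (elim x)
    then have "\<phi>' x = \<psi> x"
      by (simp add: \<phi>'_def complex_eq_iff)
    then show ?case
      using bound[of x] r[of x] M by (cases "x \<in> E") (auto simp: \<phi>_def \<psi>_eq)
  qed
  then have ae: "AE x in lebesgue. \<psi> x = \<phi> x"
    by (rule AE_completion)
  have \<phi>l [measurable]: "\<phi> \<in> borel_measurable lebesgue"
    using \<phi>m by (intro measurable_completion) simp
  have "L2_inner \<Omega> (modulated_indicator E y) (windowed_exp g \<xi>) = fourier \<phi> (\<xi> - y)" for y \<xi>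
  proof -
    let ?e = "\<lambda>x. cis (- (2 * pi * ((\<xi> - y) \<bullet> x)))"
    have em: "?e \<in> borel_measurable borel" by measurable
    then have [measurable]: "?e \<in> borel_measurable lebesgue"
      by (intro measurable_completion) simp
    have "L2_inner \<Omega> (modulated_indicator E y) (windowed_exp g \<xi>)
        = (\<integral>x. indicator \<Omega> x *\<^sub>R (modulated_indicator E y x * cnj (windowed_exp g \<xi> x)) \<partial>lebesgue)"
      unfolding L2_inner_def using \<Omega> by (intro integral_restrict_space) simp
    also have "\<dots> = (\<integral>x. ?e x * \<psi> x \<partial>lebesgue)"
    proof (intro Bochner_Integration.integral_cong refl)
      fix x
      have "exp (2 * complex_of_real pi * \<i> * complex_of_real (\<xi> \<bullet> x)) = cis (2 * pi * (\<xi> \<bullet> x))"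
        by (simp add: cis_conv_exp mult_ac)
      then have "cis (2 * pi * (y \<bullet> x)) * cnj (exp (2 * complex_of_real pi * \<i> * complex_of_real (\<xi> \<bullet> x)))
          = cis (2 * pi * (y \<bullet> x) + - (2 * pi * (\<xi> \<bullet> x)))"
        by (simp only: cis_cnj cis_mult)
      also have "2 * pi * (y \<bullet> x) + - (2 * pi * (\<xi> \<bullet> x)) = - (2 * pi * ((\<xi> - y) \<bullet> x))"
        by (simp add: inner_diff_left right_diff_distrib)
      finally have *: "cis (2 * pi * (y \<bullet> x)) * cnj (exp (2 * complex_of_real pi * \<i> * complex_of_real (\<xi> \<bullet> x))) = ?e x" .
      show "indicator \<Omega> x *\<^sub>R (modulated_indicator E y x * cnj (windowed_exp g \<xi> x)) = ?e x * \<psi> x"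
      proof (cases "x \<in> E")
        case True
        have "modulated_indicator E y x * cnj (windowed_exp g \<xi> x)
            = cis (2 * pi * (y \<bullet> x)) * cnj (exp (2 * complex_of_real pi * \<i> * complex_of_real (\<xi> \<bullet> x))) * cnj (g x)"
          using True by (simp only: modulated_indicator_def windowed_exp_def indicator_simps complex_cnj_mult mult_1_left mult_ac)
        with True E(2) show ?thesis
          unfolding * by (auto simp: \<psi>_eq)
      next
        case False
        then show ?thesis by (simp add: \<psi>_eq modulated_indicator_def)
      qed
    qed
    also have "\<dots> = (\<integral>x. ?e x * \<phi> x \<partial>lebesgue)"
      by (rule integral_cong_AE) (use ae in auto)
    also have "\<dots> = (\<integral>x. ?e x * \<phi> x \<partial>lborel)"
      by (rule integral_completion) (use em in measurable)
    finally show ?thesis by (simp add: fourier_def)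
  qed
  moreover have "(\<integral>\<^sup>+x. ennreal ((cmod (\<phi> x))\<^sup>2) \<partial>lborel) = (\<integral>\<^sup>+x. ennreal ((cmod (g x))\<^sup>2) * indicator E x \<partial>lebesgue)"
  proof -
    have "(\<integral>\<^sup>+x. ennreal ((cmod (\<phi> x))\<^sup>2) \<partial>lborel) = (\<integral>\<^sup>+x. ennreal ((cmod (\<phi> x))\<^sup>2) \<partial>lebesgue)"
      by (simp add: nn_integral_completion)
    also have "\<dots> = (\<integral>\<^sup>+x. ennreal ((cmod (g x))\<^sup>2) * indicator E x \<partial>lebesgue)"
    proof (rule nn_integral_cong_AE)
      show "AE x in lebesgue. ennreal ((cmod (\<phi> x))\<^sup>2) = ennreal ((cmod (g x))\<^sup>2) * indicator E x"
        using ae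
      proof eventually_elim
        case (elim x)
        show ?case
          unfolding elim[symmetric] \<psi>_eq by (simp add: norm_mult indicator_def)
      qed
    qed
    finally show ?thesis .
  qed
  ultimately show thesis
    by (rule that[OF \<phi>_bs])
qed

lemma borel_measurable_count_space_sum [measurable]:
  fixes P :: "real ^ 'n \<Rightarrow> ennreal"
  assumes \<Lambda>: "countable \<Lambda>" and [measurable]: "P \<in> borel_measurable borel"
  shows "(\<lambda>y. \<integral>\<^sup>+\<xi>. P (\<xi> - y) \<partial>count_space \<Lambda>) \<in> borel_measurable borel"
proof -
  interpret sigma_finite_measure "count_space \<Lambda>"
    by (rule sigma_finite_measure_count_space_countable[OF \<Lambda>])
  show ?thesis
  proof (rule borel_measurable_nn_integral)
    have "(\<lambda>(\<xi>, y). P (\<xi> - y)) \<in> borel_measurable (count_space \<Lambda> \<Otimes>\<^sub>M borel)"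
      by (rule measurable_pair_measure_countable1[OF \<Lambda>]) simp
    from measurable_pair_swap[OF this]
    show "(\<lambda>(y, \<xi>). P (\<xi> - y)) \<in> borel_measurable (borel \<Otimes>\<^sub>M count_space \<Lambda>)"
      by simp
  qed
qed

section \<open>Density inequalities on a bounded test set\<close>

text \<open>All terms are nonnegative, so the sum over \<open>\<Lambda> j\<close> alone stays below
  the Bessel bound. That bound does not depend on the modulation \<open>y\<close>, hence averaging
  over a cube multiplies it by the volume.\<close>

lemma bessel_density_bound:
  fixes \<Omega> E :: "(real ^ 'n) set"
  assumes \<Omega>: "\<Omega> \<in> sets lebesgue" "emeasure lebesgue \<Omega> < \<infinity>"
    and g: "g j \<in> L2 \<Omega>" and \<Lambda>: "countable (\<Lambda> j)" and j: "j \<in> {1..q}"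
    and bessel: "is_bessel \<Omega> q g \<Lambda> B"
    and E: "E \<in> sets lebesgue" "E \<subseteq> \<Omega>"
    and bound: "\<And>x. x \<in> E \<Longrightarrow> cmod (g j x) \<le> M" and r: "\<And>x. x \<in> E \<Longrightarrow> norm x \<le> r" and M: "0 \<le> M"
  shows "upper_density (delta (\<Lambda> j)) * (\<integral>\<^sup>+x. ennreal ((cmod (g j x))\<^sup>2) * indicator E x \<partial>lebesgue)
    \<le> ennreal (B * measure lebesgue E)"
proof -
  have gm: "g j \<in> borel_measurable (lebesgue_on \<Omega>)"
    using g by (simp add: L2_def)
  obtain \<phi> where \<phi>: "bounded_support \<phi> M r"
    and coeff: "\<And>y \<xi>. L2_inner \<Omega> (modulated_indicator E y) (windowed_exp (g j) \<xi>) = fourier \<phi> (\<xi> - y)"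
    and norm: "(\<integral>\<^sup>+x. ennreal ((cmod (\<phi> x))\<^sup>2) \<partial>lborel) = (\<integral>\<^sup>+x. ennreal ((cmod (g j x))\<^sup>2) * indicator E x \<partial>lebesgue)"
    by (rule windowed_fourier[OF \<Omega>(1) gm E bound r M]; (assumption | rule that; assumption))
  interpret bounded_support \<phi> M r by (rule \<phi>)
  define P where "P t = ennreal ((cmod (fourier \<phi> t))\<^sup>2)" for t
  have P [measurable]: "P \<in> borel_measurable borel"
    unfolding P_def[abs_def] by measurable
  let ?C = "ennreal (B * measure lebesgue E)"
  have le: "(\<integral>\<^sup>+\<xi>. P (\<xi> - y) \<partial>count_space (\<Lambda> j)) \<le> ?C" for y
  proof -
    have "(\<integral>\<^sup>+\<xi>. P (\<xi> - y) \<partial>count_space (\<Lambda> j))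
        = (\<Sum>\<^sub>\<infinity>\<xi>\<in>\<Lambda> j. ennreal ((cmod (L2_inner \<Omega> (modulated_indicator E y) (windowed_exp (g j) \<xi>)))\<^sup>2))"
      by (simp add: infsum_ennreal_count_space[OF \<Lambda>] coeff P_def)
    also have "\<dots> \<le> analysis_sum \<Omega> q g \<Lambda> (modulated_indicator E y)"
      unfolding analysis_sum_def using j by (intro member_le_sum) auto
    also have "\<dots> \<le> ?C"
      using bessel modulated_indicator_L2(1)[OF \<Omega> E, of y]
      unfolding is_bessel_def modulated_indicator_L2(2)[OF \<Omega> E, of y, symmetric] by blast
    finally show ?thesis .
  qed
  have "upper_density (delta (\<Lambda> j)) * (\<integral>\<^sup>+t. P t \<partial>lborel) \<le> ?C"
  proof (rule upper_density_mult_le[OF P sets_delta])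
    fix x :: "real ^ 'n" and h :: real assume h: "h > 0"
    have "(\<integral>\<^sup>+t. P t * emeasure (delta (\<Lambda> j)) ((+) (x + t) ` cube h) \<partial>lborel)
        = (\<integral>\<^sup>+y. (\<integral>\<^sup>+\<xi>. P (\<xi> - y) \<partial>count_space (\<Lambda> j)) * indicator ((+) x ` cube h) y \<partial>lborel)"
      by (rule nn_integral_translate_sum[OF \<Lambda> P, symmetric])
    also have "\<dots> \<le> (\<integral>\<^sup>+y. ?C * indicator ((+) x ` cube h) y \<partial>lborel)"
      using le by (intro nn_integral_mono mult_right_mono) auto
    also have "\<dots> = ?C * ennreal (h ^ CARD('n))"
      using h by (simp add: nn_integral_cmult_indicator emeasure_translate_cube)
    finally show "(\<integral>\<^sup>+t. P t * emeasure (delta (\<Lambda> j)) ((+) (x + t) ` cube h) \<partial>lborel)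
        \<le> ?C * ennreal (h ^ CARD('n))" .
  qed simp
  then show ?thesis
    unfolding P_def plancherel norm .
qed

text \<open>All windows must be kept in a lower estimate. Hence two bounds: \<open>M\<close> for
  every window, which only gives finite masses, and \<open>c\<close> for those in \<open>J'\<close>,
  which enters the result.\<close>

lemma frame_density_bound:
  fixes \<Omega> E :: "(real ^ 'n) set"
  assumes \<Omega>: "\<Omega> \<in> sets lebesgue" "emeasure lebesgue \<Omega> < \<infinity>"
    and g: "\<And>j. j \<in> {1..q} \<Longrightarrow> g j \<in> L2 \<Omega>" and \<Lambda>: "\<And>j. j \<in> {1..q} \<Longrightarrow> countable (\<Lambda> j)"
    and frame: "is_frame \<Omega> q g \<Lambda> A B"
    and E: "E \<in> sets lebesgue" "E \<subseteq> \<Omega>"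
    and bound: "\<And>j x. j \<in> {1..q} \<Longrightarrow> x \<in> E \<Longrightarrow> cmod (g j x) \<le> M"
    and r: "\<And>x. x \<in> E \<Longrightarrow> norm x \<le> r" and M: "0 \<le> M"
    and J': "J' \<subseteq> {1..q}" and zero: "\<And>j. j \<in> {1..q} - J' \<Longrightarrow> upper_density (delta (\<Lambda> j)) = 0"
    and c: "\<And>j x. j \<in> J' \<Longrightarrow> x \<in> E \<Longrightarrow> cmod (g j x) \<le> c"
    and D: "upper_density (sum_measure J' (\<lambda>j. delta (\<Lambda> j))) < \<infinity>"
  shows "ennreal (A * measure lebesgue E)
    \<le> upper_density (sum_measure J' (\<lambda>j. delta (\<Lambda> j))) * (ennreal (c\<^sup>2) * emeasure lebesgue E)"
proof -
  have "\<exists>\<phi>. bounded_support \<phi> M r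
      \<and> (\<forall>y \<xi>. L2_inner \<Omega> (modulated_indicator E y) (windowed_exp (g j) \<xi>) = fourier \<phi> (\<xi> - y))
      \<and> (\<integral>\<^sup>+x. ennreal ((cmod (\<phi> x))\<^sup>2) \<partial>lborel) = (\<integral>\<^sup>+x. ennreal ((cmod (g j x))\<^sup>2) * indicator E x \<partial>lebesgue)"
    if j: "j \<in> {1..q}" for j
  proof -
    have gm: "g j \<in> borel_measurable (lebesgue_on \<Omega>)"
      using g[OF j] by (simp add: L2_def)
    show ?thesis
      by (rule windowed_fourier[OF \<Omega>(1) gm E bound[OF j] r M]) auto
  qed
  then have "\<forall>j\<in>{1..q}. \<exists>\<phi>. bounded_support \<phi> M r
      \<and> (\<forall>y \<xi>. L2_inner \<Omega> (modulated_indicator E y) (windowed_exp (g j) \<xi>) = fourier \<phi> (\<xi> - y))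
      \<and> (\<integral>\<^sup>+x. ennreal ((cmod (\<phi> x))\<^sup>2) \<partial>lborel) = (\<integral>\<^sup>+x. ennreal ((cmod (g j x))\<^sup>2) * indicator E x \<partial>lebesgue)"
    by blast
  from bchoice[OF this] obtain \<Phi> where "\<forall>j\<in>{1..q}. bounded_support (\<Phi> j) M r
      \<and> (\<forall>y \<xi>. L2_inner \<Omega> (modulated_indicator E y) (windowed_exp (g j) \<xi>) = fourier (\<Phi> j) (\<xi> - y))
      \<and> (\<integral>\<^sup>+x. ennreal ((cmod (\<Phi> j x))\<^sup>2) \<partial>lborel) = (\<integral>\<^sup>+x. ennreal ((cmod (g j x))\<^sup>2) * indicator E x \<partial>lebesgue)"
    by blast
  then have \<Phi>: "\<And>j. j \<in> {1..q} \<Longrightarrow> bounded_support (\<Phi> j) M r"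
    and coeff: "\<And>j y \<xi>. j \<in> {1..q} \<Longrightarrow> L2_inner \<Omega> (modulated_indicator E y) (windowed_exp (g j) \<xi>) = fourier (\<Phi> j) (\<xi> - y)"
    and norm: "\<And>j. j \<in> {1..q} \<Longrightarrow> (\<integral>\<^sup>+x. ennreal ((cmod (\<Phi> j x))\<^sup>2) \<partial>lborel)
        = (\<integral>\<^sup>+x. ennreal ((cmod (g j x))\<^sup>2) * indicator E x \<partial>lebesgue)"
    by auto
  \<comment> \<open>Set to 0 off the index range, because \<open>le_upper_density_mult\<close> asks
    for measurability at every index.\<close>
  define P where "P j t = (if j \<in> {1..q} then ennreal ((cmod (fourier (\<Phi> j) t))\<^sup>2) else 0)" for j t
  have P [measurable]: "P j \<in> borel_measurable borel" for j
  proof (cases "j \<in> {1..q}")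
    case True
    then have [measurable]: "\<Phi> j \<in> borel_measurable borel"
      using \<Phi> by (simp add: bounded_support_def)
    from True show ?thesis unfolding P_def[abs_def] by simp
  next
    case False
    then have "P j = (\<lambda>_. 0)" by (simp only: P_def[abs_def] if_False)
    then show ?thesis by simp
  qed
  have fin: "emeasure lebesgue E < \<infinity>"
    using emeasure_mono[OF E(2) \<Omega>(1)] \<Omega>(2) by simp
  have P_int: "(\<integral>\<^sup>+t. P j t \<partial>lborel) = (\<integral>\<^sup>+x. ennreal ((cmod (g j x))\<^sup>2) * indicator E x \<partial>lebesgue)"
    if j: "j \<in> {1..q}" for j
    using bounded_support.plancherel[OF \<Phi>[OF j]] norm[OF j] j by (simp add: P_def)
  have P_bound: "(\<integral>\<^sup>+t. P j t \<partial>lborel) \<le> ennreal (m\<^sup>2) * emeasure lebesgue E"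
    if j: "j \<in> {1..q}" and m: "\<And>x. x \<in> E \<Longrightarrow> cmod (g j x) \<le> m" for j m
  proof -
    have "(\<integral>\<^sup>+t. P j t \<partial>lborel) \<le> (\<integral>\<^sup>+x. ennreal (m\<^sup>2) * indicator E x \<partial>lebesgue)"
      unfolding P_int[OF j]
    proof (rule nn_integral_mono)
      fix x
      show "ennreal ((cmod (g j x))\<^sup>2) * indicator E x \<le> ennreal (m\<^sup>2) * indicator E x"
        using m[of x] by (cases "x \<in> E") (auto intro!: ennreal_leI power_mono)
    qed
    also have "\<dots> = ennreal (m\<^sup>2) * emeasure lebesgue E"
      using E by (simp add: nn_integral_cmult_indicator)
    finally show ?thesis .
  qed
  let ?L = "ennreal (A * measure lebesgue E)"
  show ?thesis
  proof (rule le_upper_density_mult[where P=P and J="{1..q}"])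
    fix h :: real assume h: "h > 0"
    \<comment> \<open>Averaging over the single cube centred at the origin suffices, since the
      density of the measures takes a supremum over positions.\<close>
    have "?L * ennreal (h ^ CARD('n)) = (\<integral>\<^sup>+y. ?L * indicator ((+) (0::real ^ 'n) ` cube h) y \<partial>lborel)"
      using h by (subst nn_integral_cmult_indicator) (simp_all only: emeasure_translate_cube less_imp_le translate_cube_borel sets_lborel)
    also have "\<dots> \<le> (\<integral>\<^sup>+y. (\<Sum>j\<in>{1..q}. \<integral>\<^sup>+\<xi>. P j (\<xi> - y) \<partial>count_space (\<Lambda> j)) * indicator ((+) 0 ` cube h) y \<partial>lborel)"
    proof (intro nn_integral_mono mult_right_mono)
      fix y :: "real ^ 'n"
      have "?L \<le> analysis_sum \<Omega> q g \<Lambda> (modulated_indicator E y)"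
        using frame modulated_indicator_L2(1)[OF \<Omega> E, of y]
        unfolding is_frame_def modulated_indicator_L2(2)[OF \<Omega> E, of y, symmetric] by blast
      also have "\<dots> = (\<Sum>j\<in>{1..q}. \<integral>\<^sup>+\<xi>. P j (\<xi> - y) \<partial>count_space (\<Lambda> j))"
        unfolding analysis_sum_def using \<Lambda>
        by (intro sum.cong refl) (auto simp: infsum_ennreal_count_space coeff P_def intro!: nn_integral_cong)
      finally show "?L \<le> (\<Sum>j\<in>{1..q}. \<integral>\<^sup>+\<xi>. P j (\<xi> - y) \<partial>count_space (\<Lambda> j))" .
    qed simp
    also have "\<dots> = (\<Sum>j\<in>{1..q}. \<integral>\<^sup>+y. (\<integral>\<^sup>+\<xi>. P j (\<xi> - y) \<partial>count_space (\<Lambda> j)) * indicator ((+) 0 ` cube h) y \<partial>lborel)"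
      unfolding sum_distrib_right
    proof (rule nn_integral_sum)
      fix j assume "j \<in> {1..q}"
      then have [measurable]: "(\<lambda>y. \<integral>\<^sup>+\<xi>. P j (\<xi> - y) \<partial>count_space (\<Lambda> j)) \<in> borel_measurable borel"
        using \<Lambda> by (intro borel_measurable_count_space_sum P)
      show "(\<lambda>y. (\<integral>\<^sup>+\<xi>. P j (\<xi> - y) \<partial>count_space (\<Lambda> j)) * indicator ((+) 0 ` cube h) y) \<in> borel_measurable lborel"
        by measurable
    qed
    also have "\<dots> = (\<Sum>j\<in>{1..q}. \<integral>\<^sup>+t. P j t * emeasure (delta (\<Lambda> j)) ((+) t ` cube h) \<partial>lborel)"
    proof (rule sum.cong)
      fix j assume "j \<in> {1..q}"
      from nn_integral_translate_sum[OF \<Lambda>[OF this] P, where x=0]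
      show "(\<integral>\<^sup>+y. (\<integral>\<^sup>+\<xi>. P j (\<xi> - y) \<partial>count_space (\<Lambda> j)) * indicator ((+) 0 ` cube h) y \<partial>lborel)
        = (\<integral>\<^sup>+t. P j t * emeasure (delta (\<Lambda> j)) ((+) t ` cube h) \<partial>lborel)"
        by (simp only: add_0_left)
    qed simp
    finally show "?L * ennreal (h ^ CARD('n)) \<le> (\<Sum>j\<in>{1..q}. \<integral>\<^sup>+t. P j t * emeasure (delta (\<Lambda> j)) ((+) t ` cube h) \<partial>lborel)" .
  next
    fix j assume "j \<in> {1..q}"
    then have "(\<integral>\<^sup>+t. P j t \<partial>lborel) \<le> ennreal (M\<^sup>2) * emeasure lebesgue E"
      using bound by (intro P_bound)
    also have "\<dots> < \<infinity>"
      using fin by (simp add: ennreal_mult_less_top)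
    finally show "(\<integral>\<^sup>+t. P j t \<partial>lborel) < \<infinity>" .
  next
    fix j assume "j \<in> J'"
    then show "(\<integral>\<^sup>+t. P j t \<partial>lborel) \<le> ennreal (c\<^sup>2) * emeasure lebesgue E"
      using J' c by (intro P_bound) auto
  next
    show "ennreal (c\<^sup>2) * emeasure lebesgue E < \<infinity>"
      using fin by (simp add: ennreal_mult_less_top)
  qed (use J' zero D in simp_all)
qed

section \<open>Exceptional sets\<close>

lemma AE_lebesgue_on_countable_cover:
  fixes S :: "real \<Rightarrow> nat \<Rightarrow> 'a::euclidean_space set"
  assumes \<Omega>: "\<Omega> \<in> sets lebesgue"
    and null: "\<And>c k. Q c \<Longrightarrow> S c k \<in> null_sets lebesgue"
    and cover: "\<And>x. x \<in> \<Omega> \<Longrightarrow> \<not> R x \<Longrightarrow> \<exists>c\<in>\<rat>. \<exists>k. Q c \<and> x \<in> S c k"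
  shows "AE x in lebesgue_on \<Omega>. R x"
proof -
  have "countable {c \<in> \<rat>. Q c}"
    using countable_rat by (rule countable_subset[rotated]) auto
  then have "(\<Union>c\<in>{c \<in> \<rat>. Q c}. \<Union>k. S c k) \<in> null_sets lebesgue"
    using null by (intro null_sets_UN' null_sets_UN) auto
  then have "AE x in lebesgue. x \<notin> (\<Union>c\<in>{c \<in> \<rat>. Q c}. \<Union>k. S c k)"
    by (rule AE_not_in)
  then have "AE x in lebesgue. x \<in> \<Omega> \<longrightarrow> R x"
    by (rule eventually_mono) (use cover in blast)
  then show ?thesis
    using \<Omega> by (subst AE_restrict_space_iff) auto
qed

lemma ennreal_mult_measure:
  assumes "0 \<le> C" "emeasure M E < \<infinity>"
  shows "ennreal (C * measure M E) = ennreal C * emeasure M E"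
  using assms by (simp add: ennreal_mult emeasure_eq_ennreal_measure)

lemma esqrt_less_top: "a < \<infinity> \<Longrightarrow> esqrt a < \<infinity>"
  by (auto simp: esqrt_def)

section \<open>Rational thresholds and almost everywhere bounds\<close>

text \<open>Converts a pointwise violation of the upper bound into a rational threshold, with square
  root and quotient cleared.\<close>

lemma esqrt_divide_less_rational:
  assumes B: "0 < B" and D: "0 < D" and m: "esqrt (ennreal B / D) < ennreal m"
  obtains c where "c \<in> \<rat>" "0 < c" "c \<le> m" "ennreal B < D * ennreal (c\<^sup>2)"
proof (cases D)
  case (real d)
  with D have d: "0 < d" by simp
  have "esqrt (ennreal B / D) = ennreal (sqrt (B / d))"
    using d B by (simp add: real divide_ennreal esqrt_def)
  then have "sqrt (B / d) < m"
    using m B d by (simp add: ennreal_less_iff)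
  then obtain c where c: "c \<in> \<rat>" "sqrt (B / d) < c" "c < m"
    using Rats_dense_in_real by blast
  have "0 < sqrt (B / d)" using B d by simp
  with c have c0: "0 < c" by linarith
  have "sqrt (B / d) < sqrt (c\<^sup>2)" using c c0 by simp
  then have "B / d < c\<^sup>2" by (simp only: real_sqrt_less_iff)
  then have "B < d * c\<^sup>2" using d by (simp add: pos_divide_less_eq mult.commute)
  then have "ennreal B < D * ennreal (c\<^sup>2)"
    using B d by (simp add: real ennreal_mult[symmetric] ennreal_less_iff)
  with c c0 show thesis by (intro that) auto
next
  case top
  \<comment> \<open>For infinite \<open>D\<close> the quotient is 0, and any positive rational below
    \<open>m\<close> works.\<close>
  have "0 < m"
    using m by (metis ennreal_eq_0_iff less_le_not_le not_less zero_le)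
  then obtain c where c: "c \<in> \<rat>" "0 < c" "c < m"
    using Rats_dense_in_real by blast
  then have "ennreal B < D * ennreal (c\<^sup>2)"
    by (simp add: top ennreal_top_mult)
  with c show thesis by (intro that) auto
qed

text \<open>The counterpart for a violated lower bound. If \<open>D\<close> is 0 the quotient is
  infinite and every \<open>c\<close> works; if \<open>D\<close> is infinite the quotient is 0 and
  no violation exists, which yields the finiteness of \<open>D\<close>.\<close>

lemma less_esqrt_divide_rational:
  assumes A: "0 < A" and m: "0 \<le> m" "ennreal m < esqrt (ennreal A / D)"
  obtains c where "c \<in> \<rat>" "m \<le> c" "D < \<infinity>" "D * ennreal (c\<^sup>2) < ennreal A"
proof (cases D)
  case (real d)
  show thesis
  proof (cases "d = 0")
    case True
    obtain c where "c \<in> \<rat>" "m < c" "c < m + 1"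
      using Rats_dense_in_real[of m "m + 1"] by auto
    with that[of c] real True A show thesis by simp
  next
    case False
    with real have d: "0 < d" by simp
    have "esqrt (ennreal A / D) = ennreal (sqrt (A / d))"
      using d A by (simp add: real divide_ennreal esqrt_def)
    then have "m < sqrt (A / d)"
      using m by (simp add: ennreal_less_iff)
    then obtain c where c: "c \<in> \<rat>" "m < c" "c < sqrt (A / d)"
      using Rats_dense_in_real by blast
    have "sqrt (c\<^sup>2) < sqrt (A / d)" using c m by simp
    then have "c\<^sup>2 < A / d" by (simp only: real_sqrt_less_iff)
    then have "d * c\<^sup>2 < A" using d by (simp add: pos_less_divide_eq mult.commute)
    then have "D * ennreal (c\<^sup>2) < ennreal A"
      using A d by (simp add: real ennreal_mult[symmetric] ennreal_less_iff)
    with c real show thesis by (intro that[of c]) auto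
  qed
next
  case top
  with m(2) show thesis by (simp add: esqrt_def)
qed

text \<open>On a level set where the window is at least \<open>c\<close>, the density inequality
  gives \<open>D * c\<^sup>2\<close> times the measure at most \<open>B\<close> times the measure.
  As \<open>D * c\<^sup>2\<close> exceeds \<open>B\<close>, the measure, being finite, is 0.\<close>

lemma bessel_AE_bound:
  fixes \<Omega> :: "(real ^ 'n) set"
  assumes \<Omega>: "\<Omega> \<in> sets lebesgue" "emeasure lebesgue \<Omega> < \<infinity>"
    and g: "g j \<in> L2 \<Omega>" and \<Lambda>: "countable (\<Lambda> j)" and j: "j \<in> {1..q}"
    and bessel: "is_bessel \<Omega> q g \<Lambda> B" and D: "0 < upper_density (delta (\<Lambda> j))"
  shows "AE x in lebesgue_on \<Omega>. ennreal (cmod (g j x)) \<le> esqrt (ennreal B / upper_density (delta (\<Lambda> j)))"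
proof -
  let ?D = "upper_density (delta (\<Lambda> j))"
  \<comment> \<open>The cut-offs by \<open>k\<close> make the set and the window bounded there;
    together the \<open>k\<close> lose no point.\<close>
  define S where "S c k = {x \<in> \<Omega>. c \<le> cmod (g j x) \<and> cmod (g j x) \<le> real k \<and> norm x \<le> real k}" for c :: real and k :: nat
  have B: "0 < B" using bessel by (simp add: is_bessel_def)
  have [measurable]: "g j \<in> borel_measurable (lebesgue_on \<Omega>)" "norm \<in> borel_measurable (lebesgue_on \<Omega>)"
    using g by (auto simp: L2_def intro: lebesgue_measurable_borel)
  have S: "S c k \<in> sets lebesgue" "S c k \<subseteq> \<Omega>" for c k
  proof -
    have "{x \<in> space (lebesgue_on \<Omega>). c \<le> cmod (g j x) \<and> cmod (g j x) \<le> real k \<and> norm x \<le> real k} \<in> sets (lebesgue_on \<Omega>)"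
      by measurable
    then show "S c k \<in> sets lebesgue"
      using \<Omega>(1) by (simp add: S_def sets_restrict_space_iff)
  qed (auto simp: S_def)
  show ?thesis
  proof (rule AE_lebesgue_on_countable_cover[OF \<Omega>(1), where S=S and Q="\<lambda>c. 0 < c \<and> ennreal B < ?D * ennreal (c\<^sup>2)"])
    fix c k assume c: "0 < c \<and> ennreal B < ?D * ennreal (c\<^sup>2)"
    let ?E = "S c k"
    have fin: "emeasure lebesgue ?E < \<infinity>"
      using emeasure_mono[OF S(2) \<Omega>(1)] \<Omega>(2) by (rule le_less_trans)
    have "(?D * ennreal (c\<^sup>2)) * emeasure lebesgue ?E = ?D * (\<integral>\<^sup>+x. ennreal (c\<^sup>2) * indicator ?E x \<partial>lebesgue)"
      using S(1) by (simp add: nn_integral_cmult_indicator mult.assoc)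
    also have "\<dots> \<le> ?D * (\<integral>\<^sup>+x. ennreal ((cmod (g j x))\<^sup>2) * indicator ?E x \<partial>lebesgue)"
    proof (intro mult_left_mono nn_integral_mono)
      fix x
      show "ennreal (c\<^sup>2) * indicator ?E x \<le> ennreal ((cmod (g j x))\<^sup>2) * indicator ?E x"
        using c by (cases "x \<in> ?E") (auto simp: S_def intro!: ennreal_leI power_mono)
    qed simp
    also have "\<dots> \<le> ennreal (B * measure lebesgue ?E)"
      by (rule bessel_density_bound[where M="real k" and r="real k", OF \<Omega> g \<Lambda> j bessel S]) (auto simp: S_def)
    also have "\<dots> = ennreal B * emeasure lebesgue ?E"
      using B fin by (intro ennreal_mult_measure) auto
    finally have le: "emeasure lebesgue ?E * (?D * ennreal (c\<^sup>2)) \<le> emeasure lebesgue ?E * ennreal B"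
      by (simp only: mult.commute)
    have "emeasure lebesgue ?E = 0"
    proof (rule ccontr)
      assume "emeasure lebesgue ?E \<noteq> 0"
      with le fin have "?D * ennreal (c\<^sup>2) \<le> ennreal B"
        by (simp add: ennreal_mult_le_mult_iff)
      with c show False by auto
    qed
    then show "S c k \<in> null_sets lebesgue"
      using S(1) by auto
  next
    fix x assume x: "x \<in> \<Omega>" "\<not> ennreal (cmod (g j x)) \<le> esqrt (ennreal B / ?D)"
    then obtain c where c: "c \<in> \<rat>" "0 < c" "c \<le> cmod (g j x)" "ennreal B < ?D * ennreal (c\<^sup>2)"
      using esqrt_divide_less_rational[OF B D] by (metis not_le)
    obtain k :: nat where k: "max (cmod (g j x)) (norm x) \<le> real k"
      using real_arch_simple by blast
    from c k x show "\<exists>c\<in>\<rat>. \<exists>k. (0 < c \<and> ennreal B < ?D * ennreal (c\<^sup>2)) \<and> x \<in> S c k"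
      by (intro bexI[of _ c] exI[of _ k]) (auto simp: S_def)
  qed
qed

text \<open>With density 0 the lower frame bound becomes infinite; this is what shows that
  \<open>J'\<close> is nonempty.\<close>

lemma upper_density_sum_measure_empty: "upper_density (sum_measure {} M) = 0"
proof -
  have "emeasure (sum_measure {} M) E = 0" if "E \<in> sets borel" for E
    using that by (subst emeasure_sum_measure_finite) auto
  then have "density_at (sum_measure {} M) = (\<lambda>_. 0)"
    by (simp add: density_at_def[abs_def])
  then show ?thesis
    unfolding upper_density_eq by (simp add: Limsup_const)
qed

text \<open>Quantifying over upper bounds \<open>m\<close> instead of writing a maximum keeps the
  claim meaningful for empty \<open>J'\<close>, where \<open>Max\<close> has no specified value.
  That case is used to exclude an empty \<open>J'\<close>.\<close>

lemma frame_AE_bound: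
  fixes \<Omega> :: "(real ^ 'n) set"
  assumes \<Omega>: "\<Omega> \<in> sets lebesgue" "emeasure lebesgue \<Omega> < \<infinity>"
    and g: "\<And>j. j \<in> {1..q} \<Longrightarrow> g j \<in> L2 \<Omega>" and \<Lambda>: "\<And>j. j \<in> {1..q} \<Longrightarrow> countable (\<Lambda> j)"
    and frame: "is_frame \<Omega> q g \<Lambda> A B"
    and J': "J' \<subseteq> {1..q}" and zero: "\<And>j. j \<in> {1..q} - J' \<Longrightarrow> upper_density (delta (\<Lambda> j)) = 0"
  shows "AE x in lebesgue_on \<Omega>. \<forall>m\<ge>0. (\<forall>j\<in>J'. cmod (g j x) \<le> m) \<longrightarrow>
    esqrt (ennreal A / upper_density (sum_measure J' (\<lambda>j. delta (\<Lambda> j)))) \<le> ennreal m"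
proof -
  let ?D = "upper_density (sum_measure J' (\<lambda>j. delta (\<Lambda> j)))"
  define S where "S c k = {x \<in> \<Omega>. norm x \<le> real k \<and> (\<forall>j\<in>{1..q}. cmod (g j x) \<le> real k) \<and> (\<forall>j\<in>J'. cmod (g j x) \<le> c)}"
    for c :: real and k :: nat
  have A: "0 < A" using frame by (simp add: is_frame_def)
  have gm: "g j \<in> borel_measurable (lebesgue_on \<Omega>)" if "j \<in> {1..q}" for j
    using g[OF that] by (auto simp: L2_def)
  have [measurable]: "norm \<in> borel_measurable (lebesgue_on \<Omega>)"
    by (auto intro: lebesgue_measurable_borel)
  have fin: "finite J'" using J' finite_subset by blast
  have S: "S c k \<in> sets lebesgue" "S c k \<subseteq> \<Omega>" for c k
  proof -
    have *: "{x \<in> space (lebesgue_on \<Omega>). cmod (g j x) \<le> b} \<in> sets (lebesgue_on \<Omega>)" if "j \<in> {1..q}" for j b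
      using gm[OF that] by measurable
    have **: "{x \<in> space (lebesgue_on \<Omega>). norm x \<le> b} \<in> sets (lebesgue_on \<Omega>)" for b
      by measurable
    have "{x \<in> space (lebesgue_on \<Omega>). norm x \<le> real k \<and> (\<forall>j\<in>{1..q}. cmod (g j x) \<le> real k) \<and> (\<forall>j\<in>J'. cmod (g j x) \<le> c)}
        \<in> sets (lebesgue_on \<Omega>)"
      using J' fin by (intro sets.sets_Collect_conj sets.sets_Collect_finite_All * **) auto
    then show "S c k \<in> sets lebesgue"
      using \<Omega>(1) by (simp add: S_def sets_restrict_space_iff)
  qed (auto simp: S_def)
  show ?thesis
  proof (rule AE_lebesgue_on_countable_cover[OF \<Omega>(1), where S=S and Q="\<lambda>c. ?D < \<infinity> \<and> ?D * ennreal (c\<^sup>2) < ennreal A"])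
    fix c k assume c: "?D < \<infinity> \<and> ?D * ennreal (c\<^sup>2) < ennreal A"
    let ?E = "S c k"
    have fin: "emeasure lebesgue ?E < \<infinity>"
      using emeasure_mono[OF S(2) \<Omega>(1)] \<Omega>(2) by (rule le_less_trans)
    have "ennreal A * emeasure lebesgue ?E = ennreal (A * measure lebesgue ?E)"
      using A fin by (intro ennreal_mult_measure[symmetric]) auto
    also have "\<dots> \<le> ?D * (ennreal (c\<^sup>2) * emeasure lebesgue ?E)"
      using c by (intro frame_density_bound[where M="real k" and r="real k", OF \<Omega> g \<Lambda> frame S _ _ _ J' zero]) (auto simp: S_def)
    finally have le: "emeasure lebesgue ?E * ennreal A \<le> emeasure lebesgue ?E * (?D * ennreal (c\<^sup>2))"
      by (simp only: mult_ac)
    have "emeasure lebesgue ?E = 0"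
    proof (rule ccontr)
      assume "emeasure lebesgue ?E \<noteq> 0"
      with le fin have "ennreal A \<le> ?D * ennreal (c\<^sup>2)"
        by (simp add: ennreal_mult_le_mult_iff)
      with c show False by auto
    qed
    then show "S c k \<in> null_sets lebesgue"
      using S(1) by auto
  next
    fix x assume x: "x \<in> \<Omega>" "\<not> (\<forall>m\<ge>0. (\<forall>j\<in>J'. cmod (g j x) \<le> m) \<longrightarrow> esqrt (ennreal A / ?D) \<le> ennreal m)"
    then obtain m where m: "0 \<le> m" "\<forall>j\<in>J'. cmod (g j x) \<le> m" "ennreal m < esqrt (ennreal A / ?D)"
      by (auto simp: not_le)
    obtain c where c: "c \<in> \<rat>" "m \<le> c" "?D < \<infinity>" "?D * ennreal (c\<^sup>2) < ennreal A"
      using less_esqrt_divide_rational[OF A m(1,3)] by metis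
    obtain k :: nat where k: "Max (insert (norm x) ((\<lambda>j. cmod (g j x)) ` {1..q})) \<le> real k"
      using real_arch_simple by blast
    then have "norm x \<le> real k" "\<forall>j\<in>{1..q}. cmod (g j x) \<le> real k"
      by (simp_all add: Max_le_iff del: atLeastAtMost_iff)
    moreover have "\<forall>j\<in>J'. cmod (g j x) \<le> c"
      using m(2) c(2) by force
    ultimately show "\<exists>c\<in>\<rat>. \<exists>k. (?D < \<infinity> \<and> ?D * ennreal (c\<^sup>2) < ennreal A) \<and> x \<in> S c k"
      using c x(1) by (intro bexI[of _ c] exI[of _ k]) (simp_all add: S_def)
  qed
qed

theorem theorem3p2:
  fixes \<Omega> :: "(real ^ 'n) set" and q :: nat
    and g :: "nat \<Rightarrow> real ^ 'n \<Rightarrow> complex" and \<Lambda> :: "nat \<Rightarrow> (real ^ 'n) set"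
  assumes "\<Omega> \<in> sets lebesgue" and "emeasure lebesgue \<Omega> < \<infinity>"
    and "1 \<le> q"
    and "\<And>j. j \<in> {1..q} \<Longrightarrow> g j \<in> L2 \<Omega>"
    and "\<And>j. j \<in> {1..q} \<Longrightarrow> \<not> (AE x in lebesgue_on \<Omega>. g j x = 0)"
    and "\<And>j. j \<in> {1..q} \<Longrightarrow> countable (\<Lambda> j)"
  shows
    "(\<forall>B. \<forall>j\<in>{1..q}. is_bessel \<Omega> q g \<Lambda> B \<longrightarrow> 0 < upper_density (delta (\<Lambda> j)) \<longrightarrow>
        (AE x in lebesgue_on \<Omega>.
           ennreal (cmod (g j x)) \<le> esqrt (ennreal B / upper_density (delta (\<Lambda> j)))))
     \<and>
     (\<forall>A B. is_frame \<Omega> q g \<Lambda> A B \<longrightarrow> A < B \<longrightarrow>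
        (let J' = {j \<in> {1..q}. esssup (lebesgue_on \<Omega>) (\<lambda>x. ennreal (cmod (g j x))) < \<infinity>
                     \<and> 0 < upper_density (delta (\<Lambda> j))}
         in J' \<noteq> {} \<and>
            (AE x in lebesgue_on \<Omega>.
               esqrt (ennreal A / upper_density (sum_measure J' (\<lambda>j. delta (\<Lambda> j))))
                 \<le> ennreal (MAX j\<in>J'. cmod (g j x))
               \<and> ennreal (MAX j\<in>J'. cmod (g j x))
                 \<le> (MAX j\<in>J'. esqrt (ennreal B / upper_density (delta (\<Lambda> j)))))))"
proof (intro conjI allI ballI impI)
  fix B j
  assume "j \<in> {1..q}" "is_bessel \<Omega> q g \<Lambda> B" "0 < upper_density (delta (\<Lambda> j))"
  then show "AE x in lebesgue_on \<Omega>. ennreal (cmod (g j x)) \<le> esqrt (ennreal B / upper_density (delta (\<Lambda> j)))"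
    using assms by (intro bessel_AE_bound[of \<Omega> g j \<Lambda> q B])
next
  fix A B
  assume frame: "is_frame \<Omega> q g \<Lambda> A B"
  define J' where "J' = {j \<in> {1..q}. esssup (lebesgue_on \<Omega>) (\<lambda>x. ennreal (cmod (g j x))) < \<infinity>
                     \<and> 0 < upper_density (delta (\<Lambda> j))}"
  let ?D = "upper_density (sum_measure J' (\<lambda>j. delta (\<Lambda> j)))"
  let ?u = "\<lambda>j. esqrt (ennreal B / upper_density (delta (\<Lambda> j)))"
  have A: "0 < A" and bessel: "is_bessel \<Omega> q g \<Lambda> B"
    using frame by (auto simp: is_frame_def is_bessel_def)
  have upper: "AE x in lebesgue_on \<Omega>. ennreal (cmod (g j x)) \<le> ?u j"
    if "j \<in> {1..q}" "0 < upper_density (delta (\<Lambda> j))" for j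
    using that assms bessel by (intro bessel_AE_bound[of \<Omega> g j \<Lambda> q B])
  have J': "J' \<subseteq> {1..q}" "finite J'"
    by (auto simp: J'_def)
  \<comment> \<open>By part (i), positive density forces essential boundedness, so such a window
    would belong to \<open>J'\<close>.\<close>
  have zero: "upper_density (delta (\<Lambda> j)) = 0" if j: "j \<in> {1..q} - J'" for j
  proof (rule ccontr)
    assume "upper_density (delta (\<Lambda> j)) \<noteq> 0"
    then have pos: "0 < upper_density (delta (\<Lambda> j))"
      by (simp add: zero_less_iff_neq_zero)
    have "(\<lambda>x. ennreal (cmod (g j x))) \<in> borel_measurable (lebesgue_on \<Omega>)"
      using assms(4)[of j] j by (auto simp: L2_def)
    then have "esssup (lebesgue_on \<Omega>) (\<lambda>x. ennreal (cmod (g j x))) \<le> ?u j"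
      using upper[OF _ pos] j by (intro esssup_I) auto
    also have "\<dots> < \<infinity>"
      using pos by (intro esqrt_less_top) (auto simp: less_top[symmetric] ennreal_divide_eq_top_iff)
    finally show False
      using j pos by (auto simp: J'_def)
  qed
  have lower: "AE x in lebesgue_on \<Omega>. \<forall>m\<ge>0. (\<forall>j\<in>J'. cmod (g j x) \<le> m) \<longrightarrow> esqrt (ennreal A / ?D) \<le> ennreal m"
    using assms frame J' zero by (intro frame_AE_bound[of \<Omega> q g \<Lambda> A B J'])
  have nonempty: "J' \<noteq> {}"
  proof
    assume [simp]: "J' = {}"
    have "esqrt (ennreal A / ?D) = \<infinity>"
      using A by (simp add: upper_density_sum_measure_empty esqrt_def ennreal_divide_zero)
    with lower have "AE x in lebesgue_on \<Omega>. \<forall>m\<ge>0::real. \<infinity> \<le> ennreal m"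
      by simp
    \<comment> \<open>The inequality fails at \<open>m = 0\<close>, so almost no point of
      \<open>\<Omega>\<close> exists and the claim about \<open>g 1\<close> holds vacuously, against
      its being nonzero.\<close>
    then have "AE x in lebesgue_on \<Omega>. g 1 x = 0"
      by (rule eventually_mono) (auto dest: spec[of _ 0])
    with assms(3) assms(5)[of 1] show False by simp
  qed
  have "AE x in lebesgue_on \<Omega>. \<forall>j\<in>J'. ennreal (cmod (g j x)) \<le> ?u j"
    using J' upper by (intro AE_finite_allI) (auto simp: J'_def)
  with lower have "AE x in lebesgue_on \<Omega>. esqrt (ennreal A / ?D) \<le> ennreal (MAX j\<in>J'. cmod (g j x))
      \<and> ennreal (MAX j\<in>J'. cmod (g j x)) \<le> (MAX j\<in>J'. ?u j)"
  proof eventually_elim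
    case (elim x)
    \<comment> \<open>The maximum is attained at some \<open>j\<close>, which reduces both
      inequalities to statements about one window.\<close>
    have "(MAX j\<in>J'. cmod (g j x)) \<in> (\<lambda>j. cmod (g j x)) ` J'"
      using J' nonempty by (intro Max_in) auto
    then obtain j where j: "j \<in> J'" "(MAX j\<in>J'. cmod (g j x)) = cmod (g j x)"
      by auto
    have "esqrt (ennreal A / ?D) \<le> ennreal (MAX j\<in>J'. cmod (g j x))"
    proof -
      have "\<forall>i\<in>J'. cmod (g i x) \<le> (MAX j\<in>J'. cmod (g j x))"
        using J'(2) by simp
      moreover have "0 \<le> (MAX j\<in>J'. cmod (g j x))"
        by (simp add: j(2))
      ultimately show ?thesis
        using elim(1) by blast
    qed
    moreover have "ennreal (cmod (g j x)) \<le> (MAX j\<in>J'. ?u j)"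
      using elim(2) j(1) J' by (auto intro: order_trans[OF _ Max_ge])
    ultimately show ?case
      by (simp only: j(2) simp_thms)
  qed
  with nonempty show "let J' = {j \<in> {1..q}. esssup (lebesgue_on \<Omega>) (\<lambda>x. ennreal (cmod (g j x))) < \<infinity>
                     \<and> 0 < upper_density (delta (\<Lambda> j))}
         in J' \<noteq> {} \<and>
            (AE x in lebesgue_on \<Omega>.
               esqrt (ennreal A / upper_density (sum_measure J' (\<lambda>j. delta (\<Lambda> j))))
                 \<le> ennreal (MAX j\<in>J'. cmod (g j x))
               \<and> ennreal (MAX j\<in>J'. cmod (g j x))
                 \<le> (MAX j\<in>J'. esqrt (ennreal B / upper_density (delta (\<Lambda> j)))))"
    unfolding Let_def J'_def by blast
qed

end
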